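(* Suppose $\psi\in C^4(\mathbb R)$ is strictly convex, has uniformly bounded third and fourth derivatives, and is independent of both $d$ and $n$. Let $\phi(x)=\mathbb E[\psi(Z^\top x)]$ for $x\in\mathbb R^d$, with $Z\sim\mathcal N(0,I_d)$, let $x^*=e_1=(1,0,\dots,0)\in\mathbb R^d$, let $$v(x)=\phi(x)-\nabla\phi(x^* )^\top x=\mathbb E[\psi(Z^\top x)]-\mathbb E[\psi'(Z^\top x^* )Z^\top x],\qquad x\in\mathbb R^d,$$ and let $V=nv$. Let $\hat x=x^*$, which is the unique global minimizer of $v$, $H_V=\nabla^2V(\hat x)$, and $$L_{\mathrm{TV}}=\frac1{12}\mathbb E\big|\langle\nabla^3V(\hat x),(H_V^{-1/2}Z)^{\otimes3}\rangle\big|,\qquad\delta\hat x=-\frac12H_V^{-1}\langle\nabla^3V(\hat x),H_V^{-1}\rangle .$$ Define $a_{k,p}=\mathbb E[\psi^{(k)}(Z_1)Z_1^p]$, where $Z_1\sim\mathcal N(0,1)$. Then $$L_{\mathrm{TV}}\ge\frac{1}{a_{2,2}^{1/2}\sqrt n}\left((d-1)\frac{|a_{3,1}|}{8a_{2,0}}-\frac{|a_{3,3}|}{4a_{2,2}}\right),\qquad \|\delta\hat x\|_{H_V}=\frac{1}{2a_{2,2}^{1/2}\sqrt n}\left|(d-1)\frac{a_{3,1}}{a_{2,0}}+\frac{a_{3,3}}{a_{2,2}}\right|.$$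
   Context: $\|x\|_H=\sqrt{x^\top Hx}$. $\langle\cdot,\cdot\rangle$ is the entrywise inner product of tensors, and for a symmetric order-3 tensor $T$ and a symmetric matrix $A$, $\langle T,A\rangle\in\mathbb R^d$ has coordinates $\sum_{j,k}T_{ijk}A_{jk}$. $\psi^{(k)}$ is the $k$-th derivative. *)

theory Defs
  imports "HOL-Probability.Probability"
begin

definition C_k_real :: "nat \<Rightarrow> (real \<Rightarrow> real) \<Rightarrow> bool" where
  "C_k_real k f \<longleftrightarrow>
     (\<forall>j<k. \<forall>x. ((deriv ^^ j) f) differentiable (at x)) \<and> continuous_on UNIV ((deriv ^^ k) f)"

definition strictly_convex :: "(real \<Rightarrow> real) \<Rightarrow> bool" where
  "strictly_convex f \<longleftrightarrow>
     (\<forall>x y t. x \<noteq> y \<and> 0 < t \<and> t < 1 \<longrightarrow> f ((1 - t) * x + t * y) < (1 - t) * f x + t * f y)"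

text \<open>The law of \<open>Z \<sim> N(0, I)\<close> on \<open>\<real>\<^sup>d\<close>, where \<open>d\<close> is the cardinality of the index type;
  expectations of functions of \<open>Z\<close> are Bochner integrals against it.\<close>

definition std_gaussian :: "(real^'d) measure" where
  "std_gaussian = density lborel (\<lambda>z. ennreal (\<Prod>i\<in>UNIV. std_normal_density (z $ i)))"

definition std_normal :: "real measure" where
  "std_normal = density lborel (\<lambda>z. ennreal (std_normal_density z))"

definition partial_deriv :: "'d \<Rightarrow> (real^'d \<Rightarrow> real) \<Rightarrow> real^'d \<Rightarrow> real" where
  "partial_deriv i f x = frechet_derivative f (at x) (axis i 1)"

definition gradient :: "(real^'d \<Rightarrow> real) \<Rightarrow> real^'d \<Rightarrow> real^'d" where
  "gradient f x = (\<chi> i. partial_deriv i f x)"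

definition hessian :: "(real^'d \<Rightarrow> real) \<Rightarrow> real^'d \<Rightarrow> real^'d^'d" where
  "hessian f x = (\<chi> i j. partial_deriv i (partial_deriv j f) x)"

definition third_deriv :: "(real^'d \<Rightarrow> real) \<Rightarrow> real^'d \<Rightarrow> real^'d^'d^'d" where
  "third_deriv f x = (\<chi> i j k. partial_deriv i (partial_deriv j (partial_deriv k f)) x)"

text \<open>The entrywise inner product of two tensors of order 3 is the library's inner product
  \<open>\<bullet>\<close> on \<open>real^'d^'d^'d\<close>.\<close>

definition tensor_cube :: "real^'d \<Rightarrow> real^'d^'d^'d" where
  "tensor_cube x = (\<chi> i j k. x $ i * x $ j * x $ k)"

definition tensor_contract :: "real^'d^'d^'d \<Rightarrow> real^'d^'d \<Rightarrow> real^'d" where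
  "tensor_contract T A = (\<chi> i. \<Sum>j\<in>UNIV. \<Sum>k\<in>UNIV. T $ i $ j $ k * A $ j $ k)"

definition sym_pos_def :: "real^'d^'d \<Rightarrow> bool" where
  "sym_pos_def A \<longleftrightarrow> transpose A = A \<and> (\<forall>x. x \<noteq> 0 \<longrightarrow> 0 < x \<bullet> (A *v x))"

text \<open>\<open>H\<^sup>-\<^sup>1\<^sup>/\<^sup>2\<close>, the unique symmetric positive definite square root of \<open>H\<^sup>-\<^sup>1\<close>; meaningful only for
  symmetric positive definite \<open>H\<close>.\<close>

definition matrix_inv_sqrt :: "real^'d^'d \<Rightarrow> real^'d^'d" where
  "matrix_inv_sqrt H = (THE S. sym_pos_def S \<and> S ** S = matrix_inv H)"

definition matrix_norm :: "real^'d^'d \<Rightarrow> real^'d \<Rightarrow> real" where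
  "matrix_norm H x = sqrt (x \<bullet> (H *v x))"

definition \<phi> :: "(real \<Rightarrow> real) \<Rightarrow> real^'d \<Rightarrow> real" where
  "\<phi> \<psi> x = (\<integral>z. \<psi> (z \<bullet> x) \<partial>std_gaussian)"

definition v_risk :: "(real \<Rightarrow> real) \<Rightarrow> real^'d \<Rightarrow> real^'d \<Rightarrow> real" where
  "v_risk \<psi> xstar x = \<phi> \<psi> x - gradient (\<phi> \<psi>) xstar \<bullet> x"

definition a_coeff :: "(real \<Rightarrow> real) \<Rightarrow> nat \<Rightarrow> nat \<Rightarrow> real" where
  "a_coeff \<psi> k p = (\<integral>z. (deriv ^^ k) \<psi> z * z ^ p \<partial>std_normal)"

definition L_TV :: "(real^'d \<Rightarrow> real) \<Rightarrow> real^'d \<Rightarrow> real" where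
  "L_TV V xhat = 1 / 12 *
     (\<integral>z. \<bar>third_deriv V xhat \<bullet> tensor_cube (matrix_inv_sqrt (hessian V xhat) *v z)\<bar> \<partial>std_gaussian)"

definition delta_hat :: "(real^'d \<Rightarrow> real) \<Rightarrow> real^'d \<Rightarrow> real^'d" where
  "delta_hat V xhat = - (1 / 2) *\<^sub>R
     (matrix_inv (hessian V xhat) *v
        tensor_contract (third_deriv V xhat) (matrix_inv (hessian V xhat)))"

end

theory Submission
  imports Defs
begin

text \<open>Differentiating under the Gaussian integral, the derivatives of \<open>V\<close> at \<open>e\<^sub>1\<close> are the moment tensors
  \<open>n E[\<psi>\<^sup>(\<^sup>k\<^sup>)(Z\<^sub>1) Z\<^sup>\<otimes>\<^sup>k]\<close>. Independence and parity kill every entry in which an index other than \<open>1\<close>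
  occurs an odd number of times: the Hessian is \<open>n diag(a\<^sub>2\<^sub>2, a\<^sub>2\<^sub>0, \<dots>, a\<^sub>2\<^sub>0)\<close>, and the third derivative
  has only the entries \<open>n a\<^sub>3\<^sub>3\<close> at \<open>(1,1,1)\<close> and \<open>n a\<^sub>3\<^sub>1\<close> at the permutations of \<open>(1,j,j)\<close>. Hence
  \<open>\<langle>\<nabla>\<^sup>3V, (H\<^sup>-\<^sup>1\<^sup>/\<^sup>2Z)\<^sup>\<otimes>\<^sup>3\<rangle>\<close> is \<open>(n a\<^sub>2\<^sub>2)\<^sup>-\<^sup>1\<^sup>/\<^sup>2 (a\<^sub>3\<^sub>3/a\<^sub>2\<^sub>2 Z\<^sub>1\<^sup>3 + 3 a\<^sub>3\<^sub>1/a\<^sub>2\<^sub>0 Z\<^sub>1 \<Sum>\<^sub>j Z\<^sub>j\<^sup>2)\<close>, and the bound on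
  \<open>L\<^sub>T\<^sub>V\<close> is the reverse triangle inequality with \<open>E|Z\<^sub>1| = sqrt (2/\<pi>)\<close>, \<open>E|Z\<^sub>1|\<^sup>3 = 2 sqrt (2/\<pi>)\<close> and
  \<open>1/2 \<le> sqrt (2/\<pi>) \<le> 3/2\<close>. Minimality of \<open>e\<^sub>1\<close> is the integrated tangent line inequality for \<open>\<psi>\<close>.\<close>

subsection \<open>Functions of polynomial growth\<close>

text \<open>One class for every integrand below: it is stable under the algebraic operations,
  composition and antiderivatives on the line, and it lies in L1 of the Gaussian. Measurability is
  built in so that membership alone yields integrability.\<close>

definition poly_growth :: "('a::euclidean_space \<Rightarrow> real) \<Rightarrow> bool" where
  "poly_growth f \<longleftrightarrow> f \<in> borel_measurable borel \<and> (\<exists>C m. \<forall>z. \<bar>f z\<bar> \<le> C * (1 + norm z) ^ m)"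

lemma poly_growthE:
  assumes "poly_growth f"
  obtains C m where "0 \<le> C" "\<And>z. \<bar>f z\<bar> \<le> C * (1 + norm z) ^ m"
proof -
  obtain C m where C: "\<And>z. \<bar>f z\<bar> \<le> C * (1 + norm z) ^ m"
    using assms by (auto simp: poly_growth_def)
  have "0 \<le> C" using order_trans[OF abs_ge_zero C[of 0]] by simp
  with C show thesis using that by blast
qed

lemma poly_growth_bound:
  assumes "f \<in> borel_measurable borel" "poly_growth g" "\<And>z. \<bar>f z\<bar> \<le> g z"
  shows "poly_growth f"
  using assms unfolding poly_growth_def by (meson abs_ge_self order_trans)

lemma poly_growth_const: "poly_growth (\<lambda>z. c)"
  unfolding poly_growth_def by (auto intro!: exI[of _ "\<bar>c\<bar>"] exI[of _ "0::nat"])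

lemma poly_growth_norm: "poly_growth (\<lambda>z. norm z)"
  unfolding poly_growth_def by (auto intro!: exI[of _ 1] exI[of _ "1::nat"])

lemma poly_growth_mult:
  assumes "poly_growth f" "poly_growth g"
  shows "poly_growth (\<lambda>z. f z * g z)"
proof -
  obtain C m where 1: "0 \<le> C" "\<And>z. \<bar>f z\<bar> \<le> C * (1 + norm z) ^ m" using assms(1) by (rule poly_growthE) (rule that)
  obtain D k where 2: "0 \<le> D" "\<And>z. \<bar>g z\<bar> \<le> D * (1 + norm z) ^ k" using assms(2) by (rule poly_growthE) (rule that)
  have "\<bar>f z * g z\<bar> \<le> (C * D) * (1 + norm z) ^ (m + k)" for z
  proof -
    have "\<bar>f z * g z\<bar> \<le> (C * (1 + norm z) ^ m) * (D * (1 + norm z) ^ k)"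
      unfolding abs_mult by (intro mult_mono 1 2 abs_ge_zero mult_nonneg_nonneg) simp
    then show ?thesis by (simp add: power_add mult_ac)
  qed
  moreover have "(\<lambda>z. f z * g z) \<in> borel_measurable borel" using assms by (auto simp: poly_growth_def)
  ultimately show ?thesis unfolding poly_growth_def by blast
qed

lemma poly_growth_add:
  assumes "poly_growth f" "poly_growth g"
  shows "poly_growth (\<lambda>z. f z + g z)"
proof -
  obtain C m where 1: "0 \<le> C" "\<And>z. \<bar>f z\<bar> \<le> C * (1 + norm z) ^ m" using assms(1) by (rule poly_growthE) (rule that)
  obtain D k where 2: "0 \<le> D" "\<And>z. \<bar>g z\<bar> \<le> D * (1 + norm z) ^ k" using assms(2) by (rule poly_growthE) (rule that)
  have "\<bar>f z + g z\<bar> \<le> (C + D) * (1 + norm z) ^ (m + k)" for z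
  proof -
    have "C * (1 + norm z) ^ m \<le> C * (1 + norm z) ^ (m + k)" "D * (1 + norm z) ^ k \<le> D * (1 + norm z) ^ (m + k)"
      by (auto intro!: mult_left_mono power_increasing 1 2)
    then show ?thesis using 1(2)[of z] 2(2)[of z] by (simp add: algebra_simps)
  qed
  moreover have "(\<lambda>z. f z + g z) \<in> borel_measurable borel" using assms by (auto simp: poly_growth_def)
  ultimately show ?thesis unfolding poly_growth_def by blast
qed

lemma poly_growth_diff:
  assumes "poly_growth f" "poly_growth g" shows "poly_growth (\<lambda>z. f z - g z)"
  using poly_growth_add[OF assms(1) poly_growth_mult[OF poly_growth_const[of "-1"] assms(2)]] by simp

lemma poly_growth_sum:
  assumes "\<And>i. i \<in> I \<Longrightarrow> poly_growth (f i)" shows "poly_growth (\<lambda>z. \<Sum>i\<in>I. f i z)"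
  using assms by (induction I rule: infinite_finite_induct) (auto intro: poly_growth_const poly_growth_add)

lemma poly_growth_power: "poly_growth f \<Longrightarrow> poly_growth (\<lambda>z. f z ^ k)"
  by (induction k) (auto intro: poly_growth_const poly_growth_mult)

lemma poly_growth_abs: "poly_growth f \<Longrightarrow> poly_growth (\<lambda>z. \<bar>f z\<bar>)"
  by (auto simp: poly_growth_def)

lemma poly_growth_inner: "poly_growth (\<lambda>z. z \<bullet> x)"
  by (rule poly_growth_bound[of _ "\<lambda>z. norm z * norm x"]) (auto simp: Cauchy_Schwarz_ineq2 intro!: poly_growth_mult poly_growth_norm poly_growth_const)

lemma poly_growth_ident: "poly_growth (\<lambda>t::real. t)"
  using poly_growth_inner[of "1::real"] by simp

lemma poly_growth_nth: "poly_growth (\<lambda>z::real^'n. z $ i)"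
  using poly_growth_inner[of "axis i 1::real^'n"] by (simp add: inner_axis)

lemmas poly_growth_intros =
  poly_growth_const poly_growth_ident poly_growth_nth poly_growth_inner poly_growth_norm
  poly_growth_mult poly_growth_add poly_growth_diff poly_growth_power poly_growth_abs poly_growth_sum

lemma poly_growth_compose:
  assumes f: "poly_growth f" and g: "poly_growth g"
  shows "poly_growth (\<lambda>z. f (g z))"
proof -
  obtain C m where 1: "0 \<le> C" "\<And>z. \<bar>f z\<bar> \<le> C * (1 + norm z) ^ m" using f by (rule poly_growthE) (rule that)
  have [measurable]: "f \<in> borel_measurable borel" "g \<in> borel_measurable borel"
    using f g by (auto simp: poly_growth_def)
  show ?thesis
  proof (rule poly_growth_bound)
    show "\<bar>f (g z)\<bar> \<le> C * (1 + \<bar>g z\<bar>) ^ m" for z using 1(2)[of "g z"] by simp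
  qed (measurable, intro poly_growth_intros g)
qed

text \<open>The mean value inequality on the ball of radius \<open>\<bar>t\<bar>\<close>, where the
  bound on \<open>f'\<close> is largest at the boundary. This lets growth descend from the top
  derivative of \<open>\<psi>\<close> to \<open>\<psi>\<close> itself.\<close>

lemma poly_growth_antideriv:
  assumes "\<And>t. (f has_real_derivative f' t) (at t)" "poly_growth f'"
  shows "poly_growth f"
proof -
  obtain C m where C: "0 \<le> C" "\<And>t. \<bar>f' t\<bar> \<le> C * (1 + norm t) ^ m" using assms(2) by (rule poly_growthE) (rule that)
  have "\<bar>f t\<bar> \<le> \<bar>f 0\<bar> + norm t * (C * (1 + norm t) ^ m)" for t
  proof -
    have "norm (f t - f 0) \<le> (C * (1 + norm t) ^ m) * norm (t - 0)"
    proof (rule field_differentiable_bound[of "cball 0 \<bar>t\<bar>" f f'])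
      fix u :: real assume "u \<in> cball 0 \<bar>t\<bar>"
      then have "\<bar>u\<bar> \<le> \<bar>t\<bar>" by simp
      then have "C * (1 + norm u) ^ m \<le> C * (1 + norm t) ^ m"
        by (intro mult_left_mono power_mono C) auto
      then show "norm (f' u) \<le> C * (1 + norm t) ^ m" using C(2)[of u] by simp
    qed (auto intro: has_field_derivative_at_within[OF assms(1)])
    then show ?thesis by (simp add: mult_ac abs_if split: if_splits)
  qed
  moreover have "continuous_on UNIV f" using assms(1) DERIV_isCont continuous_at_imp_continuous_on by blast
  ultimately show ?thesis
    by (intro poly_growth_bound[of f "\<lambda>t. \<bar>f 0\<bar> + norm t * (C * (1 + norm t) ^ m)"])
       (auto simp del: real_norm_def intro!: borel_measurable_continuous_onI poly_growth_add poly_growth_mult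
         poly_growth_power poly_growth_norm poly_growth_const)
qed

text \<open>The mean value inequality is used twice on the ball of radius
  \<open>\<bar>s\<bar>\<close> about \<open>t\<close>: for \<open>f'\<close>, and then for
  \<open>f u - f' t * u\<close>, whose derivative is the increment of \<open>f'\<close> just
  bounded. All points involved have modulus at most
  \<open>\<bar>t\<bar> + \<bar>s\<bar>\<close>.\<close>

lemma taylor_remainder_poly_growth:
  assumes f: "\<And>t. (f has_real_derivative f' t) (at t)"
    and f': "\<And>t. (f' has_real_derivative f'' t) (at t)"
    and f'': "poly_growth f''"
  obtains C m where "0 \<le> C" "\<And>t s. \<bar>f (t + s) - f t - f' t * s\<bar> \<le> C * (1 + \<bar>t\<bar> + \<bar>s\<bar>) ^ m * s\<^sup>2"
proof -
  obtain C m where C: "0 \<le> C" "\<And>t. \<bar>f'' t\<bar> \<le> C * (1 + norm t) ^ m" using f'' by (rule poly_growthE) (rule that)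
  have "\<bar>f (t + s) - f t - f' t * s\<bar> \<le> C * (1 + \<bar>t\<bar> + \<bar>s\<bar>) ^ m * s\<^sup>2" for t s
  proof -
    let ?K = "C * (1 + \<bar>t\<bar> + \<bar>s\<bar>) ^ m"
    have K: "?K \<ge> 0" using C by simp
    have 1: "\<bar>f' u - f' t\<bar> \<le> ?K * \<bar>s\<bar>" if "u \<in> cball t \<bar>s\<bar>" for u
    proof -
      have "norm (f' u - f' t) \<le> ?K * norm (u - t)"
      proof (rule field_differentiable_bound[of "cball t \<bar>s\<bar>" f' f''])
        fix w :: real assume "w \<in> cball t \<bar>s\<bar>"
        then have "\<bar>w\<bar> \<le> \<bar>t\<bar> + \<bar>s\<bar>" by (auto simp: dist_real_def)
        then have "C * (1 + norm w) ^ m \<le> ?K"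
          by (intro mult_left_mono power_mono C) auto
        then show "norm (f'' w) \<le> ?K" using C(2)[of w] by simp
      qed (use that in \<open>auto intro: has_field_derivative_at_within[OF f']\<close>)
      also have "\<dots> \<le> ?K * \<bar>s\<bar>" using that K by (intro mult_left_mono) (auto simp: dist_real_def)
      finally show ?thesis by simp
    qed
    have "norm ((f (t + s) - f' t * (t + s)) - (f t - f' t * t)) \<le> ?K * \<bar>s\<bar> * norm (t + s - t)"
    proof (rule field_differentiable_bound[of "cball t \<bar>s\<bar>" "\<lambda>u. f u - f' t * u" "\<lambda>u. f' u - f' t"])
      show "((\<lambda>u. f u - f' t * u) has_real_derivative f' u - f' t) (at u within cball t \<bar>s\<bar>)" for u
        by (auto intro!: derivative_eq_intros has_field_derivative_at_within[OF f])
    qed (use 1 in \<open>auto simp: dist_real_def\<close>)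
    then show ?thesis by (simp add: algebra_simps power2_eq_square)
  qed
  with C(1) show thesis by (rule that)
qed

subsection \<open>Integrals against the standard Gaussian\<close>

lemma sets_std_gaussian [measurable_cong, simp]: "sets std_gaussian = sets borel"
  and space_std_gaussian [simp]: "space std_gaussian = UNIV"
  and sets_std_normal [measurable_cong, simp]: "sets std_normal = sets borel"
  and space_std_normal [simp]: "space std_normal = UNIV"
  by (auto simp: std_gaussian_def std_normal_def)

lemma integrable_std_normal_iff:
  fixes f :: "real \<Rightarrow> real"
  assumes "f \<in> borel_measurable borel"
  shows "integrable std_normal f \<longleftrightarrow> integrable lborel (\<lambda>t. std_normal_density t * f t)"
  unfolding std_normal_def using assms by (subst integrable_density) auto

lemma integral_std_normal_eq:
  fixes f :: "real \<Rightarrow> real"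
  assumes "f \<in> borel_measurable borel"
  shows "integral\<^sup>L std_normal f = (\<integral>t. std_normal_density t * f t \<partial>lborel)"
  unfolding std_normal_def using assms by (subst integral_density) auto

text \<open>The binomial expansion of (1 + |t|)^m reduces the claim to finiteness of the absolute
  moments.\<close>

lemma integrable_std_normal_poly_growth:
  assumes "poly_growth f" shows "integrable std_normal f"
proof -
  obtain C m where C: "0 \<le> C" "\<And>t. \<bar>f t\<bar> \<le> C * (1 + norm t) ^ m" using assms by (rule poly_growthE) (rule that)
  have "integrable std_normal (\<lambda>t. C * (\<Sum>k\<le>m. real (m choose k) * \<bar>t\<bar> ^ k))"
    by (intro integrable_mult_right integrable_sum)
       (auto simp: integrable_std_normal_iff integrable_std_normal_moment_abs)
  also have "(\<lambda>t. C * (\<Sum>k\<le>m. real (m choose k) * \<bar>t\<bar> ^ k)) = (\<lambda>t. C * (1 + \<bar>t\<bar>) ^ m)"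
    by (simp add: binomial_ring add.commute[of 1])
  finally show ?thesis
  proof (rule Bochner_Integration.integrable_bound)
    show "AE x in std_normal. norm (f x) \<le> norm (C * (1 + \<bar>x\<bar>) ^ m)"
      using C by (auto simp: abs_mult)
  qed (use assms in \<open>auto simp: poly_growth_def\<close>)
qed

lemma prob_space_std_normal: "prob_space std_normal"
  unfolding std_normal_def by (rule prob_space_normal_density) simp

lemma prod_Basis_vec:
  fixes f :: "real^'n::finite \<Rightarrow> 'b::comm_monoid_mult"
  shows "(\<Prod>b\<in>Basis. f b) = (\<Prod>i\<in>UNIV. f (axis i 1))"
proof -
  have inj: "inj (\<lambda>i. axis i 1 :: real^'n)" by (auto simp: inj_def axis_eq_axis)
  have Basis: "Basis = range (\<lambda>i. axis i 1 :: real^'n)" by (auto simp: Basis_vec_def)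
  show ?thesis unfolding Basis prod.reindex[OF inj] o_def ..
qed

text \<open>The Gaussian density factors over the coordinates, so this is Tonelli's theorem for
  Lebesgue measure.\<close>

lemma nn_integral_std_gaussian_prod:
  fixes f :: "'n::finite \<Rightarrow> real \<Rightarrow> ennreal"
  assumes [measurable]: "\<And>i. f i \<in> borel_measurable borel"
  shows "(\<integral>\<^sup>+z. (\<Prod>i\<in>UNIV. f i (z $ i)) \<partial>(std_gaussian :: (real^'n) measure)) =
    (\<Prod>i\<in>UNIV. \<integral>\<^sup>+t. f i t \<partial>std_normal)"
proof -
  \<comment> \<open>The Lebesgue product formula is indexed by \<open>Basis\<close>; the choice
    operator recovers the coordinate \<open>i\<close> from the basis vector
    \<open>axis i 1\<close>.\<close>
  define g where "g b t = ennreal (std_normal_density t) * f (SOME i. b = axis i (1::real)) t" for b :: "real^'n" and t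
  have g: "g (axis i 1) t = ennreal (std_normal_density t) * f i t" for i t
    by (simp add: g_def axis_eq_axis)
  have "(\<integral>\<^sup>+z. (\<Prod>i\<in>UNIV. f i (z $ i)) \<partial>(std_gaussian :: (real^'n) measure)) =
      (\<integral>\<^sup>+z. (\<Prod>b\<in>Basis. g b (z \<bullet> b)) \<partial>lborel)"
    unfolding std_gaussian_def
    by (subst nn_integral_density)
       (auto simp: prod_Basis_vec g inner_axis prod.distrib prod_ennreal)
  also have "\<dots> = (\<Prod>b\<in>Basis. \<integral>\<^sup>+t. g b t \<partial>lborel)"
    by (rule nn_integral_lborel_prod) (auto simp: g_def[abs_def])
  also have "\<dots> = (\<Prod>i\<in>UNIV. \<integral>\<^sup>+t. f i t \<partial>std_normal)"
    unfolding std_normal_def prod_Basis_vec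
    by (intro prod.cong refl) (subst nn_integral_density, auto intro!: nn_integral_cong simp: g)
  finally show ?thesis .
qed

text \<open>Product measures are determined by boxes, and the indicator of a box is a product of
  coordinate indicators. The identification carries Fubini for signed integrands over to
  \<open>std_gaussian\<close>.\<close>

lemma distr_std_gaussian_nth:
  "distr (std_gaussian :: (real^'n::finite) measure) (PiM UNIV (\<lambda>_. std_normal)) vec_nth =
    PiM UNIV (\<lambda>_. std_normal)" (is "distr ?G ?P _ = _")
proof -
  interpret N: prob_space std_normal by (rule prob_space_std_normal)
  interpret product_sigma_finite "\<lambda>_::'n. std_normal" ..
  have meas: "vec_nth \<in> measurable ?G ?P"
    by (rule measurable_PiM_single') (auto simp: space_PiM)
  show ?thesis
  proof (rule PiM_eqI)
    fix A :: "'n \<Rightarrow> real set" assume A: "\<And>i. i \<in> UNIV \<Longrightarrow> A i \<in> sets std_normal"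
    then have A' [measurable]: "A i \<in> sets borel" for i by simp
    have "emeasure (distr ?G ?P vec_nth) (Pi\<^sub>E UNIV A) = emeasure ?G (vec_nth -` Pi\<^sub>E UNIV A)"
      by (subst emeasure_distr[OF meas]) (auto intro!: sets_PiM_I_finite A')
    also have "\<dots> = (\<integral>\<^sup>+z. indicator (vec_nth -` Pi\<^sub>E UNIV A) z \<partial>?G)"
      using measurable_sets[OF meas, of "Pi\<^sub>E UNIV A"] by (subst nn_integral_indicator) (auto intro!: sets_PiM_I_finite A')
    also have "\<dots> = (\<integral>\<^sup>+z. (\<Prod>i\<in>UNIV. indicator (A i) (z $ i)) \<partial>?G)"
      by (intro nn_integral_cong) (auto simp: indicator_def PiE_iff prod.If_cases)
    also have "\<dots> = (\<Prod>i\<in>UNIV. emeasure std_normal (A i))"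
      by (subst nn_integral_std_gaussian_prod) (auto simp: A')
    finally show "emeasure (distr ?G ?P vec_nth) (Pi\<^sub>E UNIV A) = (\<Prod>i\<in>UNIV. emeasure std_normal (A i))" .
  qed auto
qed

lemma std_gaussian_prod:
  fixes f :: "'n::finite \<Rightarrow> real \<Rightarrow> real"
  assumes f: "\<And>i. integrable std_normal (f i)"
  shows integrable_std_gaussian_prod:
      "integrable (std_gaussian :: (real^'n) measure) (\<lambda>z. \<Prod>i\<in>UNIV. f i (z $ i))" (is ?int)
    and integral_std_gaussian_prod:
      "(\<integral>z. (\<Prod>i\<in>UNIV. f i (z $ i)) \<partial>(std_gaussian :: (real^'n) measure)) =
        (\<Prod>i\<in>UNIV. integral\<^sup>L std_normal (f i))" (is ?eq)
proof -
  interpret N: prob_space std_normal by (rule prob_space_std_normal)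
  interpret product_sigma_finite "\<lambda>_::'n. std_normal" ..
  have meas: "vec_nth \<in> measurable (std_gaussian :: (real^'n) measure) (PiM UNIV (\<lambda>_. std_normal))"
    by (rule measurable_PiM_single') (auto simp: space_PiM)
  have [measurable]: "f i \<in> borel_measurable std_normal" for i using f by (rule borel_measurable_integrable)
  have m: "(\<lambda>x. \<Prod>i\<in>UNIV. f i (x i)) \<in> borel_measurable (PiM UNIV (\<lambda>_. std_normal))"
    by measurable
  have "integrable (PiM UNIV (\<lambda>_. std_normal)) (\<lambda>x. \<Prod>i\<in>UNIV. f i (x i))"
    by (rule product_integrable_prod) (auto intro: f)
  then show ?int
    by (subst (asm) distr_std_gaussian_nth[symmetric], subst (asm) integrable_distr_eq[OF meas m])
  show ?eq
    using product_integral_prod[of UNIV f, OF finite f]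
    by (subst (asm) distr_std_gaussian_nth[symmetric], subst (asm) integral_distr[OF meas m])
qed

text \<open>Expanding the product of the factors 1 + |z_i| shows that it dominates 1 + norm z, so
  the polynomial bound is replaced by one that factors over the coordinates.\<close>

lemma integrable_std_gaussian_poly_growth:
  fixes f :: "real^'n::finite \<Rightarrow> real"
  assumes "poly_growth f" shows "integrable std_gaussian f"
proof -
  obtain C m where C: "0 \<le> C" "\<And>z. \<bar>f z\<bar> \<le> C * (1 + norm z) ^ m" using assms by (rule poly_growthE) (rule that)
  have "integrable (std_gaussian :: (real^'n) measure) (\<lambda>z. C * (\<Prod>i\<in>UNIV. (1 + \<bar>z $ i\<bar>) ^ m))"
    by (intro integrable_mult_right std_gaussian_prod(1) integrable_std_normal_poly_growth poly_growth_intros)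
  then show ?thesis
  proof (rule Bochner_Integration.integrable_bound)
    have sum_le: "1 + (\<Sum>i\<in>I. \<bar>z $ i\<bar>) \<le> (\<Prod>i\<in>I. 1 + \<bar>z $ i\<bar>)" for I and z :: "real^'n"
    proof (induction I rule: infinite_finite_induct)
      case (insert x F)
      have "1 \<le> (\<Prod>i\<in>F. 1 + \<bar>z $ i\<bar>)" by (rule prod_ge_1) auto
      then have "\<bar>z $ x\<bar> * 1 \<le> \<bar>z $ x\<bar> * (\<Prod>i\<in>F. 1 + \<bar>z $ i\<bar>)" by (intro mult_left_mono) auto
      with insert show ?case by (simp add: algebra_simps)
    qed auto
    have "\<bar>f z\<bar> \<le> C * (\<Prod>i\<in>UNIV. (1 + \<bar>z $ i\<bar>) ^ m)" for z
    proof -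
      have "1 + norm z \<le> (\<Prod>i\<in>UNIV. 1 + \<bar>z $ i\<bar>)"
        using norm_le_l1_cart[of z] sum_le[of z UNIV] by simp
      then have "C * (1 + norm z) ^ m \<le> C * (\<Prod>i\<in>UNIV. 1 + \<bar>z $ i\<bar>) ^ m"
        by (intro mult_left_mono power_mono C) auto
      with C(2)[of z] show ?thesis by (simp add: prod_power_distrib)
    qed
    then show "AE z in std_gaussian. norm (f z) \<le> norm (C * (\<Prod>i\<in>UNIV. (1 + \<bar>z $ i\<bar>) ^ m))"
      using C(1) by (auto simp: abs_mult abs_prod)
  qed (use assms in \<open>auto simp: poly_growth_def\<close>)
qed

subsection \<open>Differentiation under the integral\<close>

text \<open>Integrating the pointwise Taylor remainder leaves an error of order
  \<open>(norm h)\<^sup>2\<close>. The weight \<open>p\<close> collects the coordinate factors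
  produced by earlier differentiations, so the lemma can be iterated.\<close>

lemma gaussian_expectation_has_derivative:
  fixes p :: "real^'n::finite \<Rightarrow> real"
  assumes f: "\<And>t. (f has_real_derivative f' t) (at t)"
    and f': "\<And>t. (f' has_real_derivative f'' t) (at t)"
    and f'': "poly_growth f''" and p: "poly_growth p"
  shows "((\<lambda>x. \<integral>z. f (z \<bullet> x) * p z \<partial>std_gaussian) has_derivative
    (\<lambda>h. \<integral>z. f' (z \<bullet> x) * (z \<bullet> h) * p z \<partial>std_gaussian)) (at x)"
    (is "(?F has_derivative ?D) _")
proof -
  have gf': "poly_growth f'" using f' f'' by (rule poly_growth_antideriv)
  have gf: "poly_growth f" using f gf' by (rule poly_growth_antideriv)
  have int0: "integrable std_gaussian (\<lambda>z. f (z \<bullet> y) * p z)" for y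
    by (intro integrable_std_gaussian_poly_growth poly_growth_mult poly_growth_compose[OF gf] p poly_growth_inner)
  have int1: "integrable std_gaussian (\<lambda>z. f' (z \<bullet> y) * (z \<bullet> h) * p z)" for y h
    by (intro integrable_std_gaussian_poly_growth poly_growth_mult poly_growth_compose[OF gf'] p poly_growth_inner)
  obtain C m where C: "0 \<le> C" "\<And>t s. \<bar>f (t + s) - f t - f' t * s\<bar> \<le> C * (1 + \<bar>t\<bar> + \<bar>s\<bar>) ^ m * s\<^sup>2"
    using taylor_remainder_poly_growth[OF f f' f''] by blast
  \<comment> \<open>For \<open>norm h \<le> 1\<close> we have |z . h| \<le> norm z inside the power,
    while the square contributes (norm z)^2 (norm h)^2. With (norm h)^2 pulled out, the dominating
    function no longer depends on \<open>h\<close>.\<close>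
  define B where "B z = C * (1 + \<bar>z \<bullet> x\<bar> + norm z) ^ m * (norm z)\<^sup>2 * \<bar>p z\<bar>" for z
  have intB: "integrable std_gaussian B" unfolding B_def
    by (intro integrable_std_gaussian_poly_growth poly_growth_mult poly_growth_power poly_growth_add
        poly_growth_abs poly_growth_norm poly_growth_const poly_growth_inner p)
  define K where "K = (\<integral>z. B z \<partial>std_gaussian)"
  have bound: "\<bar>?F (x + h) - ?F x - ?D h\<bar> \<le> (norm h)\<^sup>2 * K" if h: "norm h \<le> 1" for h
  proof -
    have "?F (x + h) - ?F x - ?D h = (\<integral>z. (f (z \<bullet> x + z \<bullet> h) - f (z \<bullet> x) - f' (z \<bullet> x) * (z \<bullet> h)) * p z \<partial>std_gaussian)"
      using int0[of "x + h"] int0[of x] int1[of x h]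
      by (simp add: inner_add_right algebra_simps)
    also have "\<bar>\<dots>\<bar> \<le> (\<integral>z. (norm h)\<^sup>2 * B z \<partial>std_gaussian)"
    proof (rule integral_abs_bound_integral)
      show "integrable std_gaussian (\<lambda>z. (f (z \<bullet> x + z \<bullet> h) - f (z \<bullet> x) - f' (z \<bullet> x) * (z \<bullet> h)) * p z)"
        using int0[of "x + h"] int0[of x] int1[of x h] by (simp add: inner_add_right left_diff_distrib)
      show "integrable std_gaussian (\<lambda>z. (norm h)\<^sup>2 * B z)" using intB by simp
      fix z :: "real^'n"
      have zh: "\<bar>z \<bullet> h\<bar> \<le> norm z * norm h" by (rule Cauchy_Schwarz_ineq2)
      also have "\<dots> \<le> norm z" using h by (simp add: mult_left_le)
      finally have "C * (1 + \<bar>z \<bullet> x\<bar> + \<bar>z \<bullet> h\<bar>) ^ m \<le> C * (1 + \<bar>z \<bullet> x\<bar> + norm z) ^ m"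
        by (intro mult_left_mono power_mono C) auto
      moreover have "(z \<bullet> h)\<^sup>2 \<le> (norm z)\<^sup>2 * (norm h)\<^sup>2"
        using power_mono[OF zh, of 2] by (simp add: power_mult_distrib)
      ultimately have "C * (1 + \<bar>z \<bullet> x\<bar> + \<bar>z \<bullet> h\<bar>) ^ m * (z \<bullet> h)\<^sup>2
          \<le> C * (1 + \<bar>z \<bullet> x\<bar> + norm z) ^ m * ((norm z)\<^sup>2 * (norm h)\<^sup>2)"
        by (rule mult_mono) (use C(1) in simp_all)
      with C(2)[of "z \<bullet> x" "z \<bullet> h"]
      have "\<bar>f (z \<bullet> x + z \<bullet> h) - f (z \<bullet> x) - f' (z \<bullet> x) * (z \<bullet> h)\<bar>
          \<le> C * (1 + \<bar>z \<bullet> x\<bar> + norm z) ^ m * ((norm z)\<^sup>2 * (norm h)\<^sup>2)" by linarith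
      then have "\<bar>f (z \<bullet> x + z \<bullet> h) - f (z \<bullet> x) - f' (z \<bullet> x) * (z \<bullet> h)\<bar> * \<bar>p z\<bar>
          \<le> C * (1 + \<bar>z \<bullet> x\<bar> + norm z) ^ m * ((norm z)\<^sup>2 * (norm h)\<^sup>2) * \<bar>p z\<bar>"
        by (intro mult_right_mono) auto
      then show "\<bar>(f (z \<bullet> x + z \<bullet> h) - f (z \<bullet> x) - f' (z \<bullet> x) * (z \<bullet> h)) * p z\<bar> \<le> (norm h)\<^sup>2 * B z"
        by (simp add: abs_mult B_def mult_ac)
    qed
    finally show ?thesis by (simp add: K_def)
  qed
  show ?thesis unfolding has_derivative_at
  proof
    have "linear ?D"
    proof (rule linearI)
      show "?D (g + h) = ?D g + ?D h" for g h
        using int1[of x g] int1[of x h] by (simp add: inner_add_right algebra_simps)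
      show "?D (c *\<^sub>R h) = c *\<^sub>R ?D h" for c h
      proof -
        have "(\<lambda>z. f' (z \<bullet> x) * (z \<bullet> c *\<^sub>R h) * p z) = (\<lambda>z. c * (f' (z \<bullet> x) * (z \<bullet> h) * p z))"
          by (simp add: fun_eq_iff)
        then show ?thesis by simp
      qed
    qed
    then show "bounded_linear ?D" by (simp add: linear_conv_bounded_linear)
    show "(\<lambda>h. norm (?F (x + h) - ?F x - ?D h) / norm h) \<midarrow>0\<rightarrow> 0"
    proof (rule tendsto_sandwich[of "\<lambda>_. 0"])
      have "eventually (\<lambda>h::real^'n. norm h < 1 \<and> h \<noteq> 0) (at 0)"
        unfolding eventually_at by (intro exI[of _ 1]) (auto simp: dist_norm)
      then show "eventually (\<lambda>h. norm (?F (x + h) - ?F x - ?D h) / norm h \<le> norm h * K) (at 0)"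
      proof (rule eventually_mono)
        fix h :: "real^'n" assume "norm h < 1 \<and> h \<noteq> 0"
        then show "norm (?F (x + h) - ?F x - ?D h) / norm h \<le> norm h * K"
          using bound[of h] by (simp add: divide_simps power2_eq_square mult_ac)
      qed
      show "((\<lambda>h::real^'n. norm h * K) \<longlongrightarrow> 0) (at 0)"
        using tendsto_mult_left_zero[OF tendsto_norm_zero[OF tendsto_ident_at], of K "UNIV"] by simp
    qed auto
  qed
qed

lemma partial_deriv_eq: "(f has_derivative f') (at x) \<Longrightarrow> partial_deriv i f x = f' (axis i 1)"
  unfolding partial_deriv_def by (simp flip: frechet_derivative_at)

text \<open>The affine term makes the shape stable under iteration: it holds the linear tilt of the
  risk first, then the constant that its derivative leaves, then zero.\<close>

lemma partial_deriv_gaussian_expectation: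
  fixes p :: "real^'n::finite \<Rightarrow> real"
  assumes "\<And>t. (f has_real_derivative f' t) (at t)"
    and "\<And>t. (f' has_real_derivative f'' t) (at t)"
    and "poly_growth f''" "poly_growth p"
  shows "partial_deriv i (\<lambda>x. c * ((\<integral>z. f (z \<bullet> x) * p z \<partial>std_gaussian) - (w \<bullet> x + q))) x =
    c * ((\<integral>z. f' (z \<bullet> x) * (z $ i * p z) \<partial>std_gaussian) - w $ i)"
proof -
  have "((\<lambda>x. c * ((\<integral>z. f (z \<bullet> x) * p z \<partial>std_gaussian) - (w \<bullet> x + q))) has_derivative
    (\<lambda>h. c * ((\<integral>z. f' (z \<bullet> x) * (z \<bullet> h) * p z \<partial>std_gaussian) - (w \<bullet> h)))) (at x)"
    by (auto intro!: derivative_eq_intros gaussian_expectation_has_derivative[OF assms])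
  from partial_deriv_eq[OF this, of i] show ?thesis by (simp add: inner_axis mult.assoc)
qed

subsection \<open>Gaussian moments\<close>

lemma std_normal_moments:
  "(\<integral>t. t \<partial>std_normal) = 0" "(\<integral>t. t ^ 2 \<partial>std_normal) = 1" "(\<integral>t. t ^ 3 \<partial>std_normal) = 0"
  "(\<integral>t. \<bar>t\<bar> \<partial>std_normal) = sqrt (2 / pi)" "(\<integral>t. \<bar>t\<bar> ^ 3 \<partial>std_normal) = 2 * sqrt (2 / pi)"
  "measure std_normal UNIV = 1"
  using integral_std_normal_moment_odd[of 0] integral_std_normal_moment_even[of 1]
    integral_std_normal_moment_odd[of 1] integral_std_normal_moment_abs_odd[of 0]
    integral_std_normal_moment_abs_odd[of 1] prob_space.prob_space[OF prob_space_std_normal]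
  by (simp_all add: integral_std_normal_eq eval_nat_numeral del: power_Suc)

text \<open>Independence: the integrand is a product of functions of single coordinates, with
  \<open>g\<close> merged into the factor of coordinate \<open>k\<close>.\<close>

lemma gaussian_mixed_moment:
  fixes e :: "'n::finite \<Rightarrow> nat"
  assumes "poly_growth g"
  shows "(\<integral>z. g (z $ k) * (\<Prod>l\<in>UNIV. z $ l ^ e l) \<partial>(std_gaussian :: (real^'n) measure)) =
    (\<integral>t. g t * t ^ e k \<partial>std_normal) * (\<Prod>l\<in>UNIV-{k}. \<integral>t. t ^ e l \<partial>std_normal)"
proof -
  define f where "f l t = (if l = k then g t else 1) * t ^ e l" for l and t :: real
  have "poly_growth (f l)" for l unfolding f_def using assms by (cases "l = k") (auto intro!: poly_growth_mult poly_growth_power poly_growth_ident poly_growth_const)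
  then have "integrable std_normal (f l)" for l by (rule integrable_std_normal_poly_growth)
  then have "(\<integral>z. (\<Prod>l\<in>UNIV. f l (z $ l)) \<partial>(std_gaussian :: (real^'n) measure)) = (\<Prod>l\<in>UNIV. integral\<^sup>L std_normal (f l))"
    by (rule integral_std_gaussian_prod)
  also have "(\<lambda>z. (\<Prod>l\<in>UNIV. f l (z $ l))) = (\<lambda>z::real^'n. g (z $ k) * (\<Prod>l\<in>UNIV. z $ l ^ e l))"
    by (simp add: f_def prod.distrib)
  also have "(\<Prod>l\<in>UNIV. integral\<^sup>L std_normal (f l)) = integral\<^sup>L std_normal (f k) * (\<Prod>l\<in>UNIV-{k}. integral\<^sup>L std_normal (f l))"
    by (rule prod.remove) auto
  also have "(\<Prod>l\<in>UNIV-{k}. integral\<^sup>L std_normal (f l)) = (\<Prod>l\<in>UNIV-{k}. \<integral>t. t ^ e l \<partial>std_normal)"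
    by (rule prod.cong) (auto simp: f_def[abs_def])
  finally show ?thesis by (simp add: f_def)
qed

lemma prod_power_indicator:
  fixes z :: "real^'n::finite"
  shows "(\<Prod>l\<in>UNIV. z $ l ^ (if l = i then 1 else 0)) = z $ i"
  using prod.delta[of UNIV i "\<lambda>l. z $ l"] by (simp add: if_distrib cong: if_cong)

lemma gaussian_moment_0:
  assumes "poly_growth g"
  shows "(\<integral>z. g (z $ k) \<partial>(std_gaussian :: (real^'n::finite) measure)) = (\<integral>t. g t \<partial>std_normal)"
  using gaussian_mixed_moment[OF assms, of k "\<lambda>_. 0"] by (simp add: std_normal_moments)

lemma gaussian_moment_2:
  assumes "poly_growth g"
  shows "(\<integral>z. g (z $ k) * (z $ i * z $ j) \<partial>(std_gaussian :: (real^'n::finite) measure)) =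
    (if i \<noteq> j then 0 else if i = k then (\<integral>t. g t * t ^ 2 \<partial>std_normal) else (\<integral>t. g t \<partial>std_normal))"
proof -
  \<comment> \<open>\<open>e l\<close> counts how often \<open>l\<close> occurs among the indices.
    An index other than \<open>k\<close> contributes the factor 0 when it occurs once and 1 when it
    occurs twice or not at all.\<close>
  define e where "e l = (if l = i then 1 else 0) + (if l = j then 1 else 0 :: nat)" for l
  have "(\<Prod>l\<in>UNIV. z $ l ^ e l) = z $ i * z $ j" for z :: "real^'n"
    unfolding e_def power_add prod.distrib prod_power_indicator ..
  then have *: "(\<integral>z. g (z $ k) * (z $ i * z $ j) \<partial>(std_gaussian :: (real^'n::finite) measure)) =
      (\<integral>t. g t * t ^ e k \<partial>std_normal) * (\<Prod>l\<in>UNIV-{k}. \<integral>t. t ^ e l \<partial>std_normal)"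
    using gaussian_mixed_moment[OF assms, of k e] by (simp only:)
  have zero: "(\<Prod>l\<in>UNIV-{k}. \<integral>t. t ^ e l \<partial>std_normal) = 0" if "l \<noteq> k" "e l = 1" for l
    using that by (intro prod_zero) (auto simp: std_normal_moments intro!: bexI[of _ l])
  have one: "(\<Prod>l\<in>UNIV-{k}. \<integral>t. t ^ e l \<partial>std_normal) = 1"
    if *: "\<And>l. l \<noteq> k \<Longrightarrow> e l = 0 \<or> e l = 2"
  proof (intro prod.neutral ballI)
    fix l assume "l \<in> UNIV - {k}"
    then have "e l = 0 \<or> e l = 2" using *[of l] by auto
    then show "(\<integral>t. t ^ e l \<partial>std_normal) = 1" by (auto simp: std_normal_moments)
  qed
  show ?thesis
  proof (cases "i = j")
    case False
    \<comment> \<open>Two distinct indices cannot both equal \<open>k\<close>; the one that differs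
      occurs exactly once.\<close>
    then obtain l where l: "l \<noteq> k" "e l = 1"
      using that[of i] that[of j] by (cases "i = k") (auto simp: e_def)
    show ?thesis unfolding * zero[OF l] using False by simp
  next
    case True
    then show ?thesis unfolding * by (subst one) (auto simp: e_def numeral_2_eq_2)
  qed
qed

text \<open>Parity again: what survives is all indices equal to \<open>m\<close>, or one index equal
  to \<open>m\<close> with the other two forming a pair elsewhere. The right side is written in the
  shape of \<open>axial_tensor\<close>.\<close>

lemma gaussian_moment_3:
  fixes i j k m :: "'n::finite"
  assumes "poly_growth g"
  shows "(\<integral>z. g (z $ m) * (z $ i * (z $ j * z $ k)) \<partial>(std_gaussian :: (real^'n::finite) measure)) =
    (if i = m then if j = m then if k = m then (\<integral>t. g t * t ^ 3 \<partial>std_normal) else 0 else 0 else 0)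
    + (\<integral>t. g t * t \<partial>std_normal) * ((if i = m then if j = k then if j \<noteq> m then 1 else 0 else 0 else 0) +
       (if j = m then if i = k then if i \<noteq> m then 1 else 0 else 0 else 0) +
       (if k = m then if i = j then if i \<noteq> m then 1 else 0 else 0 else 0))"
proof -
  define e where "e l = (if l = i then 1 else 0) + ((if l = j then 1 else 0) + (if l = k then 1 else 0 :: nat))" for l
  have "(\<Prod>l\<in>UNIV. z $ l ^ e l) = z $ i * (z $ j * z $ k)" for z :: "real^'n"
    unfolding e_def power_add prod.distrib prod_power_indicator ..
  then have *: "(\<integral>z. g (z $ m) * (z $ i * (z $ j * z $ k)) \<partial>(std_gaussian :: (real^'n::finite) measure)) =
      (\<integral>t. g t * t ^ e m \<partial>std_normal) * (\<Prod>l\<in>UNIV-{m}. \<integral>t. t ^ e l \<partial>std_normal)"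
    using gaussian_mixed_moment[OF assms, of m e] by (simp only:)
  have zero: "(\<Prod>l\<in>UNIV-{m}. \<integral>t. t ^ e l \<partial>std_normal) = 0" if "l \<noteq> m" "e l = 1 \<or> e l = 3" for l
    using that by (intro prod_zero) (auto simp: std_normal_moments intro!: bexI[of _ l])
  have one: "(\<Prod>l\<in>UNIV-{m}. \<integral>t. t ^ e l \<partial>std_normal) = 1"
    if *: "\<And>l. l \<noteq> m \<Longrightarrow> e l = 0 \<or> e l = 2"
  proof (intro prod.neutral ballI)
    fix l assume "l \<in> UNIV - {m}"
    then have "e l = 0 \<or> e l = 2" using *[of l] by auto
    then show "(\<integral>t. t ^ e l \<partial>std_normal) = 1" by (auto simp: std_normal_moments)
  qed
  \<comment> \<open>Three indices in all: if every index other than \<open>m\<close> occurs an even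
    number of times, then \<open>m\<close> occurs three times or once, giving the first four cases.
    In the fifth, exponent 3 is the case of three equal indices away from \<open>m\<close>.\<close>
  consider "i = m \<and> j = m \<and> k = m" | "i = m" "j = k" "j \<noteq> m" | "j = m" "i = k" "i \<noteq> m"
    | "k = m" "i = j" "i \<noteq> m" | l where "l \<noteq> m" "e l = 1 \<or> e l = 3"
      "\<not> (i = m \<and> j = m \<and> k = m)" "\<not> (i = m \<and> j = k)" "\<not> (j = m \<and> i = k)" "\<not> (k = m \<and> i = j)"
  proof (cases "(i = m \<and> (j = k)) \<or> (j = m \<and> i = k) \<or> (k = m \<and> i = j)")
    case True with that(1-4) show ?thesis by auto
  next
    case False
    then have "(i \<noteq> m \<and> (e i = 1 \<or> e i = 3)) \<or> (j \<noteq> m \<and> (e j = 1 \<or> e j = 3)) \<or> (k \<noteq> m \<and> (e k = 1 \<or> e k = 3))"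
      unfolding e_def by (auto split: if_splits)
    with False that(5)[of i] that(5)[of j] that(5)[of k] show ?thesis by blast
  qed
  then show ?thesis
  proof cases
    case 1 then show ?thesis unfolding * by (subst one) (auto simp: e_def eval_nat_numeral)
  next
    case 2 then show ?thesis unfolding * by (subst one) (auto simp: e_def eval_nat_numeral)
  next
    case 3 then show ?thesis unfolding * by (subst one) (auto simp: e_def eval_nat_numeral)
  next
    case 4 then show ?thesis unfolding * by (subst one) (auto simp: e_def eval_nat_numeral)
  next
    case 5 then show ?thesis unfolding * using zero[of l] by auto
  qed
qed

text \<open>The covariance is the identity. This serves to show that z . u can vanish almost surely
  only for \<open>u = 0\<close>.\<close>

lemma integral_inner_square_std_gaussian:
  fixes u :: "real^'n::finite"
  shows "(\<integral>z. (z \<bullet> u)\<^sup>2 \<partial>std_gaussian) = (norm u)\<^sup>2"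
proof -
  have int: "integrable std_gaussian (\<lambda>z::real^'n. u $ i * u $ j * (1 * (z $ i * z $ j)))" for i j
    by (intro integrable_std_gaussian_poly_growth poly_growth_intros)
  have "(\<integral>z. (z \<bullet> u)\<^sup>2 \<partial>std_gaussian) = (\<integral>z. (\<Sum>i\<in>UNIV. \<Sum>j\<in>UNIV. u $ i * u $ j * (1 * (z $ i * z $ j))) \<partial>std_gaussian)"
    by (simp add: inner_vec_def power2_eq_square sum_product mult_ac)
  also have "\<dots> = (\<Sum>i\<in>UNIV. \<Sum>j\<in>UNIV. u $ i * u $ j * (\<integral>z. 1 * (z $ i * z $ j) \<partial>std_gaussian))"
    using int by (subst Bochner_Integration.integral_sum, simp)+ simp
  also have "\<dots> = (\<Sum>i\<in>UNIV. \<Sum>j\<in>UNIV. if i = j then u $ i * u $ j else 0)"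
  proof (intro sum.cong refl)
    fix i j show "u $ i * u $ j * (\<integral>z. 1 * (z $ i * z $ j) \<partial>(std_gaussian::(real^'n) measure)) = (if i = j then u $ i * u $ j else 0)"
      using gaussian_moment_2[OF poly_growth_const[of 1], where k = i and i = i and j = j] by (simp add: std_normal_moments)
  qed
  also have "\<dots> = (norm u)\<^sup>2"
    by (simp add: power2_norm_eq_inner inner_vec_def)
  finally show ?thesis .
qed

subsection \<open>Diagonal matrices\<close>

definition diag_matrix :: "('n \<Rightarrow> real) \<Rightarrow> real^'n^'n" where
  "diag_matrix h = (\<chi> i j. if i = j then h i else 0)"

lemma diag_matrix_mult_vec: "diag_matrix h *v x = (\<chi> i. h i * x $ i)"
  by (simp add: diag_matrix_def matrix_vector_mult_def vec_eq_iff if_distrib[of "\<lambda>a. a * _"] cong: if_cong)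

lemma diag_matrix_mult_left: "diag_matrix h ** A = (\<chi> i j. h i * A $ i $ j)"
  by (simp add: diag_matrix_def matrix_matrix_mult_def vec_eq_iff if_distrib[of "\<lambda>a. a * _"] cong: if_cong)

lemma diag_matrix_mult_right: "A ** diag_matrix h = (\<chi> i j. A $ i $ j * h j)"
  by (simp add: diag_matrix_def matrix_matrix_mult_def vec_eq_iff if_distrib[of "\<lambda>a. _ * a"] cong: if_cong)

lemma diag_matrix_mult: "diag_matrix h ** diag_matrix k = diag_matrix (\<lambda>i. h i * k i)"
  by (simp add: diag_matrix_mult_left) (simp add: diag_matrix_def vec_eq_iff)

lemma matrix_inv_diag_matrix:
  assumes "\<And>i. h i \<noteq> 0"
  shows "matrix_inv (diag_matrix h) = diag_matrix (\<lambda>i. 1 / h i)"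
proof -
  have one: "diag_matrix (\<lambda>i. 1) = (mat 1 :: real^'n^'n)" by (simp add: diag_matrix_def mat_def)
  have 1: "diag_matrix h ** diag_matrix (\<lambda>i. 1 / h i) = mat 1"
    "diag_matrix (\<lambda>i. 1 / h i) ** diag_matrix h = mat 1"
    using assms by (simp_all add: diag_matrix_mult one)
  \<comment> \<open>\<open>matrix_inv\<close> is a Hilbert choice; the explicit inverse witnesses
    that the chosen matrix is a two-sided inverse, and such an inverse is unique.\<close>
  then have "diag_matrix h ** matrix_inv (diag_matrix h) = mat 1 \<and> matrix_inv (diag_matrix h) ** diag_matrix h = mat 1"
    unfolding matrix_inv_def by (intro someI_ex[of "\<lambda>A'. diag_matrix h ** A' = mat 1 \<and> A' ** diag_matrix h = mat 1"]) blast
  then show ?thesis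
    using 1 by (metis matrix_mul_assoc matrix_mul_lid matrix_mul_rid)
qed

lemma sym_pos_def_diag_matrix:
  assumes "\<And>i. h i > 0" shows "sym_pos_def (diag_matrix h)"
  unfolding sym_pos_def_def
proof (intro conjI allI impI)
  show "transpose (diag_matrix h) = diag_matrix h" by (auto simp: diag_matrix_def transpose_def vec_eq_iff)
  fix x :: "real^'a" assume "x \<noteq> 0"
  then obtain i where i: "x $ i \<noteq> 0" by (auto simp: vec_eq_iff)
  have "0 < (\<Sum>i\<in>UNIV. h i * (x $ i * x $ i))"
    using assms i by (intro sum_pos2[of _ i]) (auto simp: less_imp_le zero_less_mult_iff linorder_neq_iff)
  then show "0 < x \<bullet> (diag_matrix h *v x)" by (simp add: diag_matrix_mult_vec inner_vec_def mult_ac)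
qed

text \<open>A square root \<open>S\<close> of a diagonal matrix commutes with it, hence with its diagonal root \<open>R\<close>; so
  \<open>(S + R) (S - R) = 0\<close>, and \<open>S + R\<close> is positive definite.\<close>

lemma matrix_inv_sqrt_diag_matrix:
  assumes h: "\<And>i. h i > 0"
  shows "matrix_inv_sqrt (diag_matrix h) = diag_matrix (\<lambda>i. 1 / sqrt (h i))"
  unfolding matrix_inv_sqrt_def
proof (rule the_equality)
  let ?R = "diag_matrix (\<lambda>i. 1 / sqrt (h i))"
  have inv: "matrix_inv (diag_matrix h) = diag_matrix (\<lambda>i. 1 / h i)"
    using h by (intro matrix_inv_diag_matrix) (metis less_irrefl)
  have R: "sym_pos_def ?R" using h by (intro sym_pos_def_diag_matrix) simp
  have RR: "?R ** ?R = matrix_inv (diag_matrix h)"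
    using h by (simp add: inv diag_matrix_mult less_imp_le flip: real_sqrt_mult)
  show "sym_pos_def ?R \<and> ?R ** ?R = matrix_inv (diag_matrix h)" using R RR by simp
  fix S assume S: "sym_pos_def S \<and> S ** S = matrix_inv (diag_matrix h)"
  have "S ** matrix_inv (diag_matrix h) = matrix_inv (diag_matrix h) ** S"
    using S by (metis matrix_mul_assoc)
  \<comment> \<open>Read entrywise, commutation says that \<open>S\<close> can be nonzero only where
    \<open>h i = h j\<close>. There the square roots agree as well, so \<open>S\<close> commutes
    with the diagonal root.\<close>
  then have "S $ i $ j * (1 / h j) = 1 / h i * S $ i $ j" for i j
    by (simp add: inv diag_matrix_mult_left diag_matrix_mult_right vec_eq_iff)
  then have "S $ i $ j = 0 \<or> h i = h j" for i j
    by (metis divide_inverse inverse_eq_imp_eq mult.commute mult_1 mult_right_cancel)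
  then have eq: "S $ i $ j \<noteq> 0 \<Longrightarrow> h i = h j" for i j by blast
  have comm: "S ** ?R = ?R ** S"
    unfolding diag_matrix_mult_left diag_matrix_mult_right vec_eq_iff using eq by auto metis
  have "S *v x - ?R *v x = 0" for x
  proof (rule ccontr)
    let ?y = "S *v x - ?R *v x"
    assume "?y \<noteq> 0"
    then have "0 < ?y \<bullet> (S *v ?y) + ?y \<bullet> (?R *v ?y)"
      using S R unfolding sym_pos_def_def by (simp add: add_pos_pos)
    also have "\<dots> = ?y \<bullet> (S *v ?y + ?R *v ?y)" by (simp add: inner_add_right)
    also have "S *v ?y + ?R *v ?y = 0"
      using S RR comm by (simp add: matrix_vector_mult_diff_distrib matrix_vector_mul_assoc)
    finally show False by simp
  qed
  then have "S *v x = ?R *v x" for x by simp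
  then show "S = ?R" by (simp add: matrix_eq)
qed

subsection \<open>Strict convexity\<close>

text \<open>Plain convexity puts the midpoint of \<open>x\<close> and \<open>y\<close> weakly above
  the tangent at \<open>x\<close>; strict convexity at that midpoint makes the inequality at
  \<open>y\<close> strict.\<close>

lemma strictly_convex_above_tangent:
  assumes f: "strictly_convex f" and f': "\<And>t. (f has_real_derivative f' t) (at t)" and "y \<noteq> x"
  shows "f' x * (y - x) < f y - f x"
proof -
  have less: "f ((1 - t) * x + t * y) < (1 - t) * f x + t * f y" if "x \<noteq> y" "0 < t" "t < 1" for x y t
    using f that unfolding strictly_convex_def by blast
  have "convex_on UNIV f"
  proof (rule convex_onI)
    fix t x y :: real assume t: "0 < t" "t < 1"
    show "f ((1 - t) *\<^sub>R x + t *\<^sub>R y) \<le> (1 - t) * f x + t * f y"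
    proof (cases "x = y")
      case True
      then show ?thesis by (simp add: algebra_simps)
    next
      case False
      then show ?thesis using less[of x y t] t by simp
    qed
  qed simp
  then have "f ((x + y) / 2) - f x \<ge> f' x * ((x + y) / 2 - x)"
    by (rule convex_on_imp_above_tangent) (auto intro: f')
  moreover have "f ((1 - 1/2) * x + 1/2 * y) < (1 - 1/2) * f x + 1/2 * f y"
    using \<open>y \<noteq> x\<close> by (intro less) auto
  moreover have "(1 - 1/2) * x + 1/2 * y = (x + y) / 2" by simp
  ultimately show ?thesis by (simp add: field_simps)
qed

text \<open>Adding the tangent inequalities at two points shows that \<open>f'\<close> is strictly
  increasing. A strictly convex function may have isolated zeros of \<open>f''\<close>, so only one
  nonzero value is claimed.\<close>

lemma strictly_convex_second_derivative:
  assumes f: "strictly_convex f" and f': "\<And>t. (f has_real_derivative f' t) (at t)"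
    and f'': "\<And>t. (f' has_real_derivative f'' t) (at t)"
  shows "0 \<le> f'' t" and "\<exists>t. f'' t \<noteq> 0"
proof -
  have less: "f' x < f' y" if "x < y" for x y
  proof -
    have "f' x * (y - x) < f y - f x" "f' y * (x - y) < f x - f y"
      using that by (auto intro!: strictly_convex_above_tangent[OF f f'])
    then have "0 < (f' y - f' x) * (y - x)" by (simp add: algebra_simps)
    with that show ?thesis by (simp add: zero_less_mult_iff)
  qed
  then have "mono_on UNIV f'" by (auto simp: mono_on_def le_less)
  then show "0 \<le> f'' t" by (rule mono_on_imp_deriv_nonneg[OF _ f'']) simp
  show "\<exists>t. f'' t \<noteq> 0"
  proof (rule ccontr)
    assume "\<not> ?thesis"
    then have "f' 0 = f' 1" using f'' by (intro DERIV_isconst_all) auto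
    then show False using less[of 0 1] by simp
  qed
qed

text \<open>A vanishing integral would make the nonnegative integrand zero almost everywhere; then
  the nonempty open set where \<open>g\<close> is nonzero would be Lebesgue null.\<close>

lemma integral_std_normal_even_power_pos:
  assumes cont: "continuous_on UNIV g" and g: "poly_growth g" and nonneg: "\<And>t. 0 \<le> g t" and ne: "g u \<noteq> 0"
  shows "0 < (\<integral>t. g t * t ^ (2 * k) \<partial>std_normal)"
proof -
  have int: "integrable std_normal (\<lambda>t. g t * t ^ (2 * k))"
    by (intro integrable_std_normal_poly_growth poly_growth_intros g)
  have nn: "0 \<le> g t * t ^ (2 * k)" for t using nonneg by simp
  have "(\<integral>t. g t * t ^ (2 * k) \<partial>std_normal) \<noteq> 0"
  proof
    assume "(\<integral>t. g t * t ^ (2 * k) \<partial>std_normal) = 0"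
    then have "AE t in std_normal. g t * t ^ (2 * k) = 0"
      by (subst (asm) integral_nonneg_eq_0_iff_AE[OF int]) (auto simp: nn)
    then have "AE t in lborel. g t * t ^ (2 * k) = 0"
      unfolding std_normal_def by (subst (asm) AE_density) (auto simp: normal_density_pos)
    \<comment> \<open>Away from the origin the even power is nonzero and can be cancelled.\<close>
    with AE_lborel_singleton[of "0::real"] have "AE t in lborel. t \<notin> {t. g t \<noteq> 0}"
      by eventually_elim auto
    moreover have op: "open {t. g t \<noteq> 0}" using cont by (intro open_Collect_neq) auto
    ultimately have "{t. g t \<noteq> 0} \<in> null_sets lborel"
      by (simp add: AE_iff_null_sets)
    then have "negligible {t. g t \<noteq> 0}"
      by (simp add: negligible_iff_null_sets null_sets_completionI)
    with open_not_negligible[OF op] ne show False by auto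
  qed
  moreover have "0 \<le> (\<integral>t. g t * t ^ (2 * k) \<partial>std_normal)" using nn by (rule Bochner_Integration.integral_nonneg)
  ultimately show ?thesis by simp
qed

subsection \<open>The third derivative tensor\<close>

lemma sum_if_const: "(\<Sum>x\<in>A. if P then f x else 0) = (if P then \<Sum>x\<in>A. f x else 0)"
  by simp

lemma sum_if_neq_const:
  fixes k :: "'n::finite"
  shows "(\<Sum>i\<in>UNIV. if i = k then 0 else c) = (real CARD('n) - 1) * c"
  by (simp add: sum.If_cases Collect_neg_eq[symmetric] card_Diff_singleton Compl_eq_Diff_UNIV of_nat_diff)

text \<open>Nested conditionals rather than conjunctions, so that \<open>sum.delta\<close> collapses the index sums.\<close>

definition axial_tensor :: "'n \<Rightarrow> real \<Rightarrow> real \<Rightarrow> real^'n^'n^'n" where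
  "axial_tensor k \<alpha> \<beta> = (\<chi> i j l. (if i = k then if j = k then if l = k then \<alpha> else 0 else 0 else 0)
    + \<beta> * ((if i = k then if j = l then if j \<noteq> k then 1 else 0 else 0 else 0) +
       (if j = k then if i = l then if i \<noteq> k then 1 else 0 else 0 else 0) +
       (if l = k then if i = j then if i \<noteq> k then 1 else 0 else 0 else 0)))"

text \<open>The three positions of the single index \<open>k\<close> contribute equally, which gives
  the factor 3.\<close>

lemma axial_tensor_inner_tensor_cube:
  "axial_tensor k \<alpha> \<beta> \<bullet> tensor_cube y =
    \<alpha> * (y $ k) ^ 3 + 3 * \<beta> * (y $ k) * (\<Sum>i\<in>UNIV. if i = k then 0 else (y $ i)\<^sup>2)"
proof -
  have "axial_tensor k \<alpha> \<beta> \<bullet> tensor_cube y =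
     (\<Sum>i\<in>UNIV. \<Sum>j\<in>UNIV. \<Sum>l\<in>UNIV. if i = k then if j = k then if l = k then \<alpha> * (y $ i * y $ j * y $ l) else 0 else 0 else 0) +
     (\<Sum>i\<in>UNIV. \<Sum>j\<in>UNIV. \<Sum>l\<in>UNIV. if i = k then if j = l then if j = k then 0 else \<beta> * (y $ i * y $ j * y $ l) else 0 else 0) +
     (\<Sum>i\<in>UNIV. \<Sum>j\<in>UNIV. \<Sum>l\<in>UNIV. if j = k then if i = l then if i = k then 0 else \<beta> * (y $ i * y $ j * y $ l) else 0 else 0) +
     (\<Sum>i\<in>UNIV. \<Sum>j\<in>UNIV. \<Sum>l\<in>UNIV. if l = k then if i = j then if i = k then 0 else \<beta> * (y $ i * y $ j * y $ l) else 0 else 0)"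
    unfolding axial_tensor_def tensor_cube_def inner_vec_def sum.distrib[symmetric]
    by (intro sum.cong refl) auto
  also have "\<dots> = \<alpha> * (y $ k) ^ 3 + (\<Sum>i\<in>UNIV. if i = k then 0 else \<beta> * (y $ k * y $ i * y $ i)) +
      (\<Sum>i\<in>UNIV. if i = k then 0 else \<beta> * (y $ i * y $ k * y $ i)) +
      (\<Sum>i\<in>UNIV. if i = k then 0 else \<beta> * (y $ i * y $ i * y $ k))"
    by (simp add: sum_if_const power3_eq_cube)
  also have "\<dots> = \<alpha> * (y $ k) ^ 3 + 3 * \<beta> * (y $ k) * (\<Sum>i\<in>UNIV. if i = k then 0 else (y $ i)\<^sup>2)"
  proof -
    have "3 * \<beta> * (y $ k) * (\<Sum>i\<in>UNIV. if i = k then 0 else (y $ i)\<^sup>2) =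
        (\<Sum>i\<in>UNIV. (if i = k then 0 else \<beta> * (y $ k * y $ i * y $ i)) +
          ((if i = k then 0 else \<beta> * (y $ i * y $ k * y $ i)) + (if i = k then 0 else \<beta> * (y $ i * y $ i * y $ k))))"
      unfolding sum_distrib_left by (intro sum.cong refl) (auto simp: power2_eq_square)
    then show ?thesis by (simp only: sum.distrib add.assoc)
  qed
  finally show ?thesis .
qed

text \<open>A diagonal matrix sees only the entries (i,j,j), and these vanish unless
  \<open>i = k\<close>; the contraction therefore lies on the axis \<open>k\<close>.\<close>

lemma axial_tensor_contract_diag_matrix:
  "tensor_contract (axial_tensor k \<alpha> \<beta>) (diag_matrix u) =
    axis k (\<alpha> * u k + \<beta> * (\<Sum>j\<in>UNIV. if j = k then 0 else u j))"
proof -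
  have "(\<Sum>j\<in>UNIV. \<Sum>l\<in>UNIV. axial_tensor k \<alpha> \<beta> $ i $ j $ l * diag_matrix u $ j $ l) =
      (if i = k then \<alpha> * u k + \<beta> * (\<Sum>j\<in>UNIV. if j = k then 0 else u j) else 0)" for i
  proof -
    have "(\<Sum>j\<in>UNIV. \<Sum>l\<in>UNIV. axial_tensor k \<alpha> \<beta> $ i $ j $ l * diag_matrix u $ j $ l) =
      (\<Sum>j\<in>UNIV. \<Sum>l\<in>UNIV. if j = l then axial_tensor k \<alpha> \<beta> $ i $ j $ j * u j else 0)"
      by (intro sum.cong refl) (auto simp: diag_matrix_def)
    also have "\<dots> = (\<Sum>j\<in>UNIV. axial_tensor k \<alpha> \<beta> $ i $ j $ j * u j)" by simp
    also have "\<dots> = (\<Sum>j\<in>UNIV. (if j = k then if i = k then \<alpha> * u j else 0 else 0)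
        + (if i = k then \<beta> * (if j = k then 0 else u j) else 0))"
      by (intro sum.cong refl) (auto simp: axial_tensor_def)
    also have "\<dots> = (if i = k then \<alpha> * u k + \<beta> * (\<Sum>j\<in>UNIV. if j = k then 0 else u j) else 0)"
      by (simp add: sum.distrib sum_if_const sum_distrib_left)
    finally show ?thesis .
  qed
  then show ?thesis by (simp add: tensor_contract_def axis_def vec_eq_iff)
qed

lemma integral_std_gaussian_abs_times_squares:
  "(\<integral>z. \<bar>z $ k\<bar> * (\<Sum>i\<in>UNIV. if i = k then 0 else (z $ i)\<^sup>2) \<partial>(std_gaussian :: (real^'n::finite) measure)) =
    (real CARD('n) - 1) * sqrt (2 / pi)"
proof -
  let ?G = "std_gaussian :: (real^'n) measure"
  have abs: "poly_growth (\<lambda>t::real. \<bar>t\<bar>)" by (intro poly_growth_intros)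
  have "(\<integral>z. \<bar>z $ k\<bar> * (\<Sum>i\<in>UNIV. if i = k then 0 else (z $ i)\<^sup>2) \<partial>?G) =
      (\<integral>z. (\<Sum>i\<in>UNIV. if i = k then 0 else \<bar>z $ k\<bar> * (z $ i * z $ i)) \<partial>?G)"
    by (simp add: sum_distrib_left power2_eq_square if_distrib cong: if_cong)
  also have "\<dots> = (\<Sum>i\<in>UNIV. \<integral>z. (if i = k then 0 else \<bar>z $ k\<bar> * (z $ i * z $ i)) \<partial>?G)"
  proof (rule Bochner_Integration.integral_sum)
    fix i show "integrable ?G (\<lambda>z. if i = k then 0 else \<bar>z $ k\<bar> * (z $ i * z $ i))"
      by (cases "i = k") (auto intro!: integrable_std_gaussian_poly_growth poly_growth_mult poly_growth_abs poly_growth_nth)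
  qed
  also have "\<dots> = (\<Sum>i\<in>UNIV. if i = k then 0 else sqrt (2 / pi))"
    using gaussian_moment_2[OF abs, where k = k] by (intro sum.cong refl) (auto simp: std_normal_moments)
  finally show ?thesis by (simp add: sum_if_neq_const)
qed

text \<open>The quadratic sum is nonnegative, so the reverse triangle inequality can be integrated
  pointwise; the two resulting expectations are explicit.\<close>

lemma integral_std_gaussian_abs_cubic_ge:
  fixes k :: "'n::finite"
  shows "(\<integral>z. \<bar>p * (z $ k) ^ 3 + q * (z $ k) * (\<Sum>i\<in>UNIV. if i = k then 0 else (z $ i)\<^sup>2)\<bar> \<partial>(std_gaussian :: (real^'n) measure))
    \<ge> sqrt (2 / pi) * (\<bar>q\<bar> * (real CARD('n) - 1) - 2 * \<bar>p\<bar>)"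
proof -
  let ?G = "std_gaussian :: (real^'n) measure"
  let ?Q = "\<lambda>z::real^'n. \<Sum>i\<in>UNIV. if i = k then 0 else (z $ i)\<^sup>2"
  have Q: "poly_growth ?Q"
  proof (rule poly_growth_sum)
    show "poly_growth (\<lambda>z::real^'n. if i = k then 0 else (z $ i)\<^sup>2)" for i
      by (cases "i = k") (auto intro!: poly_growth_power poly_growth_nth poly_growth_const)
  qed
  have int: "integrable ?G (\<lambda>z. \<bar>z $ k\<bar> * ?Q z)" "integrable ?G (\<lambda>z. \<bar>z $ k\<bar> ^ 3)"
    "integrable ?G (\<lambda>z. \<bar>p * (z $ k) ^ 3 + q * (z $ k) * ?Q z\<bar>)"
    by (intro integrable_std_gaussian_poly_growth poly_growth_mult poly_growth_abs poly_growth_power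
        poly_growth_nth poly_growth_add poly_growth_const Q)+
  have "sqrt (2 / pi) * (\<bar>q\<bar> * (real CARD('n) - 1) - 2 * \<bar>p\<bar>) =
      (\<integral>z. \<bar>q\<bar> * (\<bar>z $ k\<bar> * ?Q z) - \<bar>p\<bar> * \<bar>z $ k\<bar> ^ 3 \<partial>?G)"
  proof -
    have "(\<integral>z. \<bar>z $ k\<bar> ^ 3 \<partial>?G) = 2 * sqrt (2 / pi)"
      by (subst gaussian_moment_0) (auto intro!: poly_growth_power poly_growth_abs poly_growth_ident simp: std_normal_moments)
    then show ?thesis using int by (simp add: integral_std_gaussian_abs_times_squares algebra_simps)
  qed
  also have "\<dots> \<le> (\<integral>z. \<bar>p * (z $ k) ^ 3 + q * (z $ k) * ?Q z\<bar> \<partial>?G)"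
  proof (rule integral_mono)
    fix z :: "real^'n"
    have "0 \<le> ?Q z" by (intro sum_nonneg) auto
    then show "\<bar>q\<bar> * (\<bar>z $ k\<bar> * ?Q z) - \<bar>p\<bar> * \<bar>z $ k\<bar> ^ 3 \<le> \<bar>p * (z $ k) ^ 3 + q * (z $ k) * ?Q z\<bar>"
      using abs_triangle_ineq2[of "q * (z $ k) * ?Q z" "- (p * (z $ k) ^ 3)"]
      by (simp add: abs_mult power_abs mult_ac add.commute)
  qed (use int in auto)
  finally show ?thesis .
qed

text \<open>Crude rational bounds are enough: the lower one serves the main term of the estimate,
  the upper one the subtracted term.\<close>

lemma sqrt_2_div_pi_bounds: "1 / 2 \<le> sqrt (2 / pi)" "sqrt (2 / pi) \<le> 3 / 2"
proof -
  have "(1 / 2)\<^sup>2 \<le> 2 / pi" using pi_less_4 pi_gt_zero by (simp add: field_simps power2_eq_square)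
  then show "1 / 2 \<le> sqrt (2 / pi)" by (rule real_le_rsqrt)
  have "2 / pi \<le> (3 / 2)\<^sup>2" using pi_ge_two by (simp add: field_simps power2_eq_square)
  then show "sqrt (2 / pi) \<le> 3 / 2" by (intro real_le_lsqrt) auto
qed

subsection \<open>The risk\<close>

lemma C_k_real_has_derivative:
  assumes "C_k_real m f" "j < m"
  shows "((deriv ^^ j) f has_real_derivative (deriv ^^ Suc j) f t) (at t)"
  using assms by (auto simp: C_k_real_def DERIV_deriv_iff_real_differentiable)

lemma C_k_real_continuous_on:
  assumes "C_k_real m f" "j \<le> m"
  shows "continuous_on UNIV ((deriv ^^ j) f)"
proof (cases "j = m")
  case False
  then show ?thesis
    using C_k_real_has_derivative[OF assms(1), of j] assms(2)
    by (intro continuous_at_imp_continuous_on ballI) (auto intro: DERIV_isCont)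
qed (use assms in \<open>simp add: C_k_real_def\<close>)

text \<open>Downward induction from the bounded top derivative, one antiderivative at a
  time.\<close>

lemma C_k_real_poly_growth:
  assumes f: "C_k_real m f" and bounded: "bounded (range ((deriv ^^ m) f))" and "j \<le> m"
  shows "poly_growth ((deriv ^^ j) f)"
  using \<open>j \<le> m\<close>
proof (induction j rule: inc_induct)
  case base
  obtain B where "\<And>t. \<bar>(deriv ^^ m) f t\<bar> \<le> B" using bounded by (auto simp: bounded_iff)
  then show ?case
    by (intro poly_growth_bound[OF _ poly_growth_const[of B]] borel_measurable_continuous_onI
        C_k_real_continuous_on[OF f]) auto
next
  case (step j)
  show ?case by (rule poly_growth_antideriv[OF C_k_real_has_derivative[OF f]]) (use step in auto)
qed

theorem lemma2p28:
  fixes \<psi> :: "real \<Rightarrow> real" and n :: real and i1 :: "'d::finite"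
    and xhat :: "real^'d" and v V :: "real^'d \<Rightarrow> real" and a :: "nat \<Rightarrow> nat \<Rightarrow> real"
  assumes smooth: "C_k_real 4 \<psi>"
    and convex: "strictly_convex \<psi>"
    and bounded3: "bounded (range ((deriv ^^ 3) \<psi>))"
    and bounded4: "bounded (range ((deriv ^^ 4) \<psi>))"
    and n_pos: "n > 0"
    and xhat: "xhat = axis i1 1"
    and v: "v = v_risk \<psi> xhat"
    and V: "V = (\<lambda>x. n * v x)"
    and a: "a = a_coeff \<psi>"
  shows "(\<forall>x. v x = (\<integral>z. \<psi> (z \<bullet> x) \<partial>std_gaussian)
                   - (\<integral>z. deriv \<psi> (z \<bullet> xhat) * (z \<bullet> x) \<partial>std_gaussian))
       \<and> (\<forall>x. x \<noteq> xhat \<longrightarrow> v xhat < v x)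
       \<and> L_TV V xhat \<ge> 1 / (sqrt (a 2 2) * sqrt n) *
            ((real CARD('d) - 1) * (\<bar>a 3 1\<bar> / (8 * a 2 0)) - \<bar>a 3 3\<bar> / (4 * a 2 2))
       \<and> matrix_norm (hessian V xhat) (delta_hat V xhat) = 1 / (2 * sqrt (a 2 2) * sqrt n) *
            \<bar>(real CARD('d) - 1) * (a 3 1 / a 2 0) + a 3 3 / a 2 2\<bar>"
proof -
  let ?G = "std_gaussian :: (real^'d) measure"
  let ?d = "\<lambda>k. (deriv ^^ k) \<psi>"
  have der: "(?d j has_real_derivative ?d (Suc j) t) (at t)" if "j < 4" for j t
    using smooth that by (rule C_k_real_has_derivative)
  have growth: "poly_growth (?d j)" if "j \<le> 4" for j
    using smooth bounded4 that by (rule C_k_real_poly_growth)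
  have growth0: "poly_growth \<psi>" and growth1: "poly_growth (deriv \<psi>)"
    using growth[of 0] growth[of 1] by simp_all
  have growth3: "poly_growth (?d 3)" by (rule growth) simp
  \<comment> \<open>Differentiating the expectation of \<open>?d j\<close> uses the derivatives of
    order \<open>j + 1\<close> and \<open>j + 2\<close>, so order four allows \<open>j\<close> up to
    2, that is, three differentiations.\<close>
  have partial: "partial_deriv i (\<lambda>x. c * ((\<integral>z. ?d j (z \<bullet> x) * p z \<partial>?G) - (w \<bullet> x + q))) x =
      c * ((\<integral>z. ?d (Suc j) (z \<bullet> x) * (z $ i * p z) \<partial>?G) - w $ i)"
    if "j < 3" "poly_growth p" for i j c p w q x
    using that by (intro partial_deriv_gaussian_expectation[OF der der growth]) auto
  have poly1: "poly_growth (\<lambda>z::real^'d. z $ i * 1)" and poly2: "poly_growth (\<lambda>z::real^'d. z $ i * (z $ j * 1))" for i j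
    by (intro poly_growth_intros)+

  \<comment> \<open>The gradient at the minimizer and the formula for the risk\<close>
  define g where "g = gradient (\<phi> \<psi>) xhat"
  have g: "g $ i = (\<integral>z. ?d 1 (z \<bullet> xhat) * z $ i \<partial>?G)" for i
    using partial[where j = 0 and i = i and c = 1 and w = 0 and q = 0 and x = xhat, OF _ poly_growth_const[of 1]] by (simp add: g_def gradient_def \<phi>_def[abs_def])
  \<comment> \<open>The trivial factor 1 and summand 0 bring the risk into the shape required by
    \<open>partial\<close>.\<close>
  have v_eq: "v x = (\<integral>z. ?d 0 (z \<bullet> x) * 1 \<partial>?G) - (g \<bullet> x + 0)" for x
    by (simp add: v v_risk_def \<phi>_def g_def)
  have int0: "integrable ?G (\<lambda>z. \<psi> (z \<bullet> x))" for x
    by (intro integrable_std_gaussian_poly_growth poly_growth_compose[OF growth0] poly_growth_inner)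
  have int1: "integrable ?G (\<lambda>z. deriv \<psi> (z \<bullet> x) * (z \<bullet> y))" for x y
    by (intro integrable_std_gaussian_poly_growth poly_growth_mult poly_growth_compose[OF growth1] poly_growth_inner)
  have v1: "v x = (\<integral>z. \<psi> (z \<bullet> x) \<partial>?G) - (\<integral>z. deriv \<psi> (z \<bullet> xhat) * (z \<bullet> x) \<partial>?G)" for x
  proof -
    have "g \<bullet> x = (\<Sum>i\<in>UNIV. \<integral>z. deriv \<psi> (z \<bullet> xhat) * (z $ i * x $ i) \<partial>?G)"
      unfolding inner_vec_def g by (simp add: mult.assoc flip: integral_mult_left_zero)
    also have "\<dots> = (\<integral>z. (\<Sum>i\<in>UNIV. deriv \<psi> (z \<bullet> xhat) * (z $ i * x $ i)) \<partial>?G)"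
      by (intro Bochner_Integration.integral_sum[symmetric] integrable_std_gaussian_poly_growth poly_growth_mult
          poly_growth_nth poly_growth_const poly_growth_compose[OF growth1] poly_growth_inner)
    also have "\<dots> = (\<integral>z. deriv \<psi> (z \<bullet> xhat) * (z \<bullet> x) \<partial>?G)"
      by (simp add: inner_vec_def sum_distrib_left)
    finally show ?thesis by (simp add: v_eq)
  qed

  have der0: "(\<psi> has_real_derivative deriv \<psi> t) (at t)" and der1: "(deriv \<psi> has_real_derivative ?d 2 t) (at t)" for t
    using der[of 0 t] der[of 1 t] by (simp_all add: numeral_2_eq_2)

  \<comment> \<open>Strict global minimality\<close>
  have min: "v xhat < v x" if "x \<noteq> xhat" for x
  proof -
    \<comment> \<open>The gap between \<open>\<psi>\<close> at z . x and its tangent taken at z .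
      xhat; its expectation is the difference of the risks.\<close>
    define r where "r z = \<psi> (z \<bullet> x) - \<psi> (z \<bullet> xhat) - deriv \<psi> (z \<bullet> xhat) * (z \<bullet> (x - xhat))" for z
    have int: "integrable ?G r" unfolding r_def using int0 int1 by auto
    have r_pos: "0 < r z" if "z \<bullet> (x - xhat) \<noteq> 0" for z
      using strictly_convex_above_tangent[OF convex der0, of "z \<bullet> x" "z \<bullet> xhat"] that
      by (simp add: r_def inner_diff_right)
    then have r_nonneg: "0 \<le> r z" for z by (cases "z \<bullet> (x - xhat) = 0") (auto simp: r_def inner_diff_right less_imp_le)
    have "v x - v xhat = integral\<^sup>L ?G r"
      unfolding v1 r_def using int0 int1 by (simp add: inner_diff_right right_diff_distrib)
    moreover have "integral\<^sup>L ?G r \<noteq> 0"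
    proof
      assume "integral\<^sup>L ?G r = 0"
      then have "AE z in ?G. r z = 0"
        using integral_nonneg_eq_0_iff_AE[OF int] r_nonneg by simp
      \<comment> \<open>The gap is positive wherever z . (x - xhat) is nonzero, so a zero
        expectation would force the second moment, which equals the squared norm of
        \<open>x - xhat\<close>, to vanish.\<close>
      then have "AE z in ?G. (z \<bullet> (x - xhat))\<^sup>2 = 0"
        by eventually_elim (use r_pos in force)
      then have "(\<integral>z. (z \<bullet> (x - xhat))\<^sup>2 \<partial>?G) = 0" by (rule integral_eq_zero_AE)
      with \<open>x \<noteq> xhat\<close> show False by (simp add: integral_inner_square_std_gaussian)
    qed
    moreover have "0 \<le> integral\<^sup>L ?G r" using r_nonneg by (intro Bochner_Integration.integral_nonneg)
    ultimately show ?thesis by linarith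
  qed

  \<comment> \<open>Positivity of the two Hessian coefficients\<close>
  obtain u where u: "?d 2 u \<noteq> 0" using strictly_convex_second_derivative(2)[OF convex der0 der1] by blast
  have a2_pos: "0 < a 2 (2 * k)" for k
    unfolding a a_coeff_def
    by (rule integral_std_normal_even_power_pos[where u = u])
      (auto intro: C_k_real_continuous_on[OF smooth] growth
        strictly_convex_second_derivative(1)[OF convex der0 der1] simp: u)
  have a20: "0 < a 2 0" and a22: "0 < a 2 2" using a2_pos[of 0] a2_pos[of 1] by auto

  \<comment> \<open>The first three derivatives of \<open>V\<close>\<close>
  have V_eq: "V = (\<lambda>x. n * ((\<integral>z. ?d 0 (z \<bullet> x) * 1 \<partial>?G) - (g \<bullet> x + 0)))"
    by (simp add: V v_eq)
  \<comment> \<open>The tilt has become the constant \<open>g $ i\<close>; with zero linear part it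
    drops out at the next differentiation.\<close>
  have V1: "partial_deriv i V = (\<lambda>x. n * ((\<integral>z. ?d 1 (z \<bullet> x) * (z $ i * 1) \<partial>?G) - (0 \<bullet> x + g $ i)))" for i
    unfolding V_eq by (rule ext, subst partial) (auto intro: poly_growth_const)
  have V2: "partial_deriv i (partial_deriv j V) =
      (\<lambda>x. n * ((\<integral>z. ?d 2 (z \<bullet> x) * (z $ i * (z $ j * 1)) \<partial>?G) - (0 \<bullet> x + 0)))" for i j
    unfolding V1 by (rule ext, subst partial) (auto simp: numeral_2_eq_2 intro: poly_growth_nth)
  have V3: "partial_deriv i (partial_deriv j (partial_deriv k V)) x =
      n * (\<integral>z. ?d 3 (z \<bullet> x) * (z $ i * (z $ j * z $ k)) \<partial>?G)" for i j k x
    unfolding V2 by (subst partial[OF _ poly2]) (auto simp: eval_nat_numeral)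

  \<comment> \<open>Hessian and third derivative at the minimizer\<close>
  define h where "h i = n * (if i = i1 then a 2 2 else a 2 0)" for i
  have h_pos: "0 < h i" for i using n_pos a20 a22 by (simp add: h_def)
  have h_i1: "h i1 = n * a 2 2" by (simp add: h_def)
  have H: "hessian V xhat = diag_matrix h"
  proof -
    have "partial_deriv i (partial_deriv j V) xhat = (if i = j then h i else 0)" for i j
      \<comment> \<open>Since \<open>xhat\<close> is the axis vector, z . xhat is the coordinate
        \<open>z $ i1\<close>, so the moment formulas apply with the derivative of
        \<open>\<psi>\<close> as \<open>g\<close>.\<close>
      using gaussian_moment_2[OF growth[of 2], where k = i1 and i = i and j = j]
      by (auto simp: V2 xhat inner_axis h_def a a_coeff_def)
    then show ?thesis by (simp add: hessian_def diag_matrix_def)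
  qed
  have T: "third_deriv V xhat = axial_tensor i1 (n * a 3 3) (n * a 3 1)"
  proof -
    have "partial_deriv i (partial_deriv j (partial_deriv k V)) xhat = axial_tensor i1 (n * a 3 3) (n * a 3 1) $ i $ j $ k" for i j k
      unfolding V3 xhat inner_axis a a_coeff_def axial_tensor_def inner_real_def mult_1_right power_one_right
        gaussian_moment_3[OF growth3, where m = i1 and i = i and j = j and k = k]
      by (simp add: distrib_left)
    then show ?thesis by (simp add: third_deriv_def vec_eq_iff)
  qed
  have H_inv: "matrix_inv (diag_matrix h) = diag_matrix (\<lambda>i. 1 / h i)"
    using h_pos by (intro matrix_inv_diag_matrix) (metis less_irrefl)
  \<comment> \<open>The axial entry of the inverse square root of the Hessian, and the common scale
    of both results.\<close>
  define \<kappa> where "\<kappa> = 1 / sqrt (h i1)"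
  have \<kappa>_pos: "0 < \<kappa>" using h_pos by (simp add: \<kappa>_def)
  have \<kappa>: "\<kappa> = 1 / (sqrt (a 2 2) * sqrt n)" by (simp add: \<kappa>_def h_def real_sqrt_mult)
  have \<kappa>2: "\<kappa>\<^sup>2 = 1 / (n * a 2 2)" using h_pos[of i1] by (simp add: \<kappa>_def power_divide h_def)

  \<comment> \<open>The lower bound\<close>
  have "L_TV V xhat \<ge> \<kappa> * ((real CARD('d) - 1) * (\<bar>a 3 1\<bar> / (8 * a 2 0)) - \<bar>a 3 3\<bar> / (4 * a 2 2))"
  proof -
    have "third_deriv V xhat \<bullet> tensor_cube (matrix_inv_sqrt (hessian V xhat) *v z) =
        (\<kappa> * (a 3 3 / a 2 2)) * (z $ i1) ^ 3 +
        (\<kappa> * (3 * (a 3 1 / a 2 0))) * (z $ i1) * (\<Sum>i\<in>UNIV. if i = i1 then 0 else (z $ i)\<^sup>2)" for z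
    proof -
      have "(\<Sum>i\<in>UNIV. if i = i1 then 0 else (1 / sqrt (h i) * z $ i)\<^sup>2) =
          1 / (n * a 2 0) * (\<Sum>i\<in>UNIV. if i = i1 then 0 else (z $ i)\<^sup>2)"
        unfolding sum_distrib_left using n_pos a20
        by (intro sum.cong refl) (auto simp: h_def power_mult_distrib power_divide)
      moreover have "n * a 3 3 * (\<kappa> * z $ i1) ^ 3 = (\<kappa> * (a 3 3 / a 2 2)) * (z $ i1) ^ 3"
      proof -
        \<comment> \<open>One factor \<open>\<kappa>\<close> is kept as the scale; the other two
          give \<open>1 / (n * a 2 2)\<close> and cancel \<open>n\<close>. In the mixed term the
          off-axis entries cancel it.\<close>
        have "n * a 3 3 * (\<kappa> * z $ i1) ^ 3 = n * a 3 3 * \<kappa> * \<kappa>\<^sup>2 * (z $ i1) ^ 3"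
          by (simp add: power3_eq_cube power2_eq_square)
        then show ?thesis using n_pos a22 unfolding \<kappa>2 by simp
      qed
      moreover have "third_deriv V xhat \<bullet> tensor_cube (matrix_inv_sqrt (hessian V xhat) *v z) =
          n * a 3 3 * (\<kappa> * z $ i1) ^ 3 + 3 * (n * a 3 1) * (\<kappa> * z $ i1) *
            (\<Sum>i\<in>UNIV. if i = i1 then 0 else (1 / sqrt (h i) * z $ i)\<^sup>2)"
        by (simp only: H T matrix_inv_sqrt_diag_matrix[OF h_pos] axial_tensor_inner_tensor_cube
            diag_matrix_mult_vec vec_lambda_beta \<kappa>_def)
      ultimately show ?thesis using n_pos by simp
    qed
    then have "12 * L_TV V xhat \<ge> sqrt (2 / pi) *
        (\<bar>\<kappa> * (3 * (a 3 1 / a 2 0))\<bar> * (real CARD('d) - 1) - 2 * \<bar>\<kappa> * (a 3 3 / a 2 2)\<bar>)"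
      unfolding L_TV_def
      using integral_std_gaussian_abs_cubic_ge[where 'n = 'd and k = i1 and p = "\<kappa> * (a 3 3 / a 2 2)"
          and q = "\<kappa> * (3 * (a 3 1 / a 2 0))"]
      by (simp only:)
    also have "sqrt (2 / pi) * (\<bar>\<kappa> * (3 * (a 3 1 / a 2 0))\<bar> * (real CARD('d) - 1) - 2 * \<bar>\<kappa> * (a 3 3 / a 2 2)\<bar>) =
        sqrt (2 / pi) * (3 * \<kappa> * ((real CARD('d) - 1) * (\<bar>a 3 1\<bar> / a 2 0)))
        - sqrt (2 / pi) * (2 * \<kappa> * (\<bar>a 3 3\<bar> / a 2 2))"
      using \<kappa>_pos a20 a22 by (simp add: abs_mult algebra_simps)
    finally have "12 * L_TV V xhat \<ge> \<dots>" .
    moreover have "1 / 2 * (3 * \<kappa> * ((real CARD('d) - 1) * (\<bar>a 3 1\<bar> / a 2 0)))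
        \<le> sqrt (2 / pi) * (3 * \<kappa> * ((real CARD('d) - 1) * (\<bar>a 3 1\<bar> / a 2 0)))"
      using \<kappa>_pos a20 by (intro mult_right_mono sqrt_2_div_pi_bounds mult_nonneg_nonneg) auto
    moreover have "sqrt (2 / pi) * (2 * \<kappa> * (\<bar>a 3 3\<bar> / a 2 2)) \<le> 3 / 2 * (2 * \<kappa> * (\<bar>a 3 3\<bar> / a 2 2))"
      using \<kappa>_pos a22 by (intro mult_right_mono sqrt_2_div_pi_bounds mult_nonneg_nonneg) auto
    \<comment> \<open>The constants match: 12/8 = 3 * (1/2) and 12/4 = 2 * (3/2).\<close>
    moreover have "12 * (\<kappa> * ((real CARD('d) - 1) * (\<bar>a 3 1\<bar> / (8 * a 2 0)) - \<bar>a 3 3\<bar> / (4 * a 2 2))) =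
        1 / 2 * (3 * \<kappa> * ((real CARD('d) - 1) * (\<bar>a 3 1\<bar> / a 2 0))) - 3 / 2 * (2 * \<kappa> * (\<bar>a 3 3\<bar> / a 2 2))"
      using a20 a22 by (simp add: field_simps)
    ultimately show ?thesis by linarith
  qed

  \<comment> \<open>The norm of the correction\<close>
  moreover have "matrix_norm (hessian V xhat) (delta_hat V xhat) =
      \<kappa> / 2 * \<bar>(real CARD('d) - 1) * (a 3 1 / a 2 0) + a 3 3 / a 2 2\<bar>"
  proof -
    \<comment> \<open>The axial coordinate of the contraction; the factor \<open>n\<close> of the
      tensor cancels that of the inverse Hessian.\<close>
    define w where "w = (real CARD('d) - 1) * (a 3 1 / a 2 0) + a 3 3 / a 2 2"
    have "(\<Sum>j\<in>UNIV. if j = i1 then 0 else 1 / h j) = (real CARD('d) - 1) * (1 / (n * a 2 0))"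
      unfolding sum_if_neq_const[of i1, symmetric] by (intro sum.cong refl) (simp add: h_def)
    then have "tensor_contract (third_deriv V xhat) (matrix_inv (hessian V xhat)) = axis i1 w"
      using n_pos by (simp add: T H H_inv axial_tensor_contract_diag_matrix w_def h_i1 add.commute
        mult.commute)
    then have "delta_hat V xhat = - (1 / 2) *\<^sub>R (diag_matrix (\<lambda>i. 1 / h i) *v axis i1 w)"
      by (simp only: delta_hat_def H H_inv)
    also have "\<dots> = axis i1 (- w / (2 * h i1))"
      by (simp add: diag_matrix_mult_vec axis_def vec_eq_iff)
    finally have \<delta>: "delta_hat V xhat = axis i1 (- w / (2 * h i1))" .
    have "matrix_norm (hessian V xhat) (delta_hat V xhat) = sqrt (- w / (2 * h i1) * (h i1 * (- w / (2 * h i1))))"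
      unfolding \<delta> H matrix_norm_def diag_matrix_mult_vec inner_axis' by (simp add: axis_def)
    \<comment> \<open>On the axis the quadratic form is w^2 / (4 h), where h is the axial Hessian
      entry \<open>h i1\<close>, and \<open>\<kappa>\<^sup>2\<close> is its reciprocal.\<close>
    also have "\<dots> = sqrt ((\<kappa> / 2 * \<bar>w\<bar>)\<^sup>2)"
      using h_pos[of i1] by (simp add: \<kappa>_def power_mult_distrib power_divide) (simp add: power2_eq_square field_simps)
    also have "\<dots> = \<kappa> / 2 * \<bar>w\<bar>" using \<kappa>_pos by (simp add: real_sqrt_abs)
    finally show ?thesis by (simp add: w_def)
  qed
  ultimately show ?thesis using v1 min by (simp add: \<kappa>)
qed

end
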